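(* Let $I=[0,b]$ with $b>0$ and let $G$ be a subgroup of $\mathrm{PL}_o(I)$ that satisfies the following conditions: (i) no interior point of $I$ is fixed by (every element of) $G$; (ii) the characters $\chi_\ell$ and $\chi_r$ of $G$ are both non-zero; (iii) the quotient group $G/(\ker\chi_\ell\cdot\ker\chi_r)$ is a torsion group; (iv) at least one of the groups $U(\operatorname{im}\chi_\ell)$ and $U(\operatorname{im}\chi_r)$ is equal to $\{1,-1\}$. Then there exists a non-trivial homomorphism $\psi\colon G\to\mathbb{R}^\times_{>0}$ such that $\psi\circ\alpha=\psi$ for every automorphism $\alpha$ of $G$. The group $G$ therefore has property $R_\infty$.
   Context: $\mathrm{PL}_o([0,b])$ is the group of orientation preserving piecewise linear homeomorphisms (with finitely many break points) of $[0,b]$. For $g\in G$, $\sigma_\ell(g)$ is the right derivative of $g$ at $0$ and $\sigma_r(g)$ is the left derivative of $g$ at $b$; the characters $\chi_\ell,\chi_r\colon G\to\mathbb{R}$ (homomorphisms into the additive group $\mathbb{R}$) are $\chi_\ell=\ln\circ\,\sigma_\ell$ and $\chi_r=\ln\circ\,\sigma_r$. For a subgroup $B$ of the additive group $\mathbb{R}$, the group of units of $B$ is $U(B)=\{s\in\mathbb{R}^\times\mid s\cdot B=B\}$. For an automorphism $\alpha$ of a group $G$, the $\alpha$-twisted conjugacy classes are the orbits of the action of $G$ on its underlying set given by $(g,x)\mapsto g\cdot x\cdot \alpha(g)^{-1}$. A group $G$ has property $R_\infty$ if for every automorphism $\alpha$ of $G$ there are infinitely many $\alpha$-twisted conjugacy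 classes. *)

theory Defs
  imports "HOL-Analysis.Analysis" "HOL-Algebra.Group_Action"
begin

text \<open>The finite set P contains the break points: the map is affine on every closed subinterval
  whose interior misses P. As these subintervals include their end points, continuity at the
  break points is enforced.\<close>

definition piecewise_linear_on :: "real \<Rightarrow> real \<Rightarrow> (real \<Rightarrow> real) \<Rightarrow> bool" where
  "piecewise_linear_on a b f \<longleftrightarrow>
     (\<exists>P. finite P \<and>
       (\<forall>x y. a \<le> x \<and> x \<le> y \<and> y \<le> b \<and> {x<..<y} \<inter> P = {} \<longrightarrow>
         (\<exists>m c. \<forall>t\<in>{x..y}. f t = m * t + c)))"

text \<open>Elements are extensional (undefined outside the interval), as in \<^const>\<open>BijGroup\<close>, so that
  equality of group elements is equality of maps of the interval. The product is composition,
  with the right factor applied first.\<close>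

definition PLo_carrier :: "real \<Rightarrow> (real \<Rightarrow> real) set" where
  "PLo_carrier b = {f \<in> Bij {0..b}.
     (\<exists>f'. homeomorphism {0..b} {0..b} f f') \<and>
     strict_mono_on {0..b} f \<and> piecewise_linear_on 0 b f}"

definition PLo :: "real \<Rightarrow> (real \<Rightarrow> real) monoid" where
  "PLo b = BijGroup {0..b} \<lparr>carrier := PLo_carrier b\<rparr>"

lemma PLo_carrier_subgroup: "subgroup (PLo_carrier b) (BijGroup {0..b})"
proof -
  let ?I = "{0..b}"
  interpret B: group "BijGroup ?I" by (rule group_BijGroup)
  show ?thesis
  proof (rule B.subgroupI)
    show "PLo_carrier b \<subseteq> carrier (BijGroup ?I)"
      by (auto simp: PLo_carrier_def BijGroup_def)
    have "(\<lambda>x\<in>?I. x) \<in> PLo_carrier b"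
      unfolding PLo_carrier_def
    proof (intro CollectI conjI)
      show "(\<lambda>x\<in>?I. x) \<in> Bij ?I" by (rule id_Bij)
      show "\<exists>f'. homeomorphism ?I ?I (\<lambda>x\<in>?I. x) f'"
        by (intro exI[of _ id] homeomorphism_cong[OF homeomorphism_ident[unfolded id_def]]) auto
      show "strict_mono_on ?I (\<lambda>x\<in>?I. x)" by (auto simp: strict_mono_on_def)
      show "piecewise_linear_on 0 b (\<lambda>x\<in>?I. x)"
        unfolding piecewise_linear_on_def
        by (intro exI[of _ "{}"] conjI allI impI exI[of _ 1] exI[of _ 0]) auto
    qed
    then show "PLo_carrier b \<noteq> {}" by blast
  next
    fix f assume f: "f \<in> PLo_carrier b"
    then have fB: "f \<in> Bij ?I" and sm: "strict_mono_on ?I f" and pl: "piecewise_linear_on 0 b f"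
      unfolding PLo_carrier_def by blast+
    obtain f' where hf: "homeomorphism ?I ?I f f'" using f unfolding PLo_carrier_def by blast
    define g where "g = (\<lambda>x\<in>?I. inv_into ?I f x)"
    have bij: "bij_betw f ?I ?I" using fB by (simp add: Bij_def)
    have gf: "f' x = g x" "g x \<in> ?I" "f (g x) = x" if "x \<in> ?I" for x
    proof -
      have x: "x \<in> f ` ?I" using that bij_betw_imp_surj_on[OF bij] by blast
      show 2: "g x \<in> ?I" using inv_into_into[OF x] that unfolding g_def by (simp only: restrict_apply if_True)
      show 3: "f (g x) = x" using f_inv_into_f[OF x] that unfolding g_def by (simp only: restrict_apply if_True)
      show "f' x = g x" using homeomorphism_apply1[OF hf 2] unfolding 3 .
    qed
    have fg: "g (f x) = x" "f x \<in> ?I" if "x \<in> ?I" for x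
    proof -
      show 1: "f x \<in> ?I" using bij_betwE[OF bij] that by blast
      show "g (f x) = x"
        using 1 inv_into_f_f[OF bij_betw_imp_inj_on[OF bij] that] unfolding g_def by (simp only: restrict_apply if_True)
    qed
    have less: "g x < g y \<longleftrightarrow> x < y" if xy: "x \<in> ?I" "y \<in> ?I" for x y
    proof -
      have "x < y" if "g x < g y"
        using strict_mono_onD[OF sm gf(2)[OF xy(1)] gf(2)[OF xy(2)] that]
        by (simp only: gf(3)[OF xy(1)] gf(3)[OF xy(2)])
      moreover have "y < x" if "g y < g x"
        using strict_mono_onD[OF sm gf(2)[OF xy(2)] gf(2)[OF xy(1)] that]
        by (simp only: gf(3)[OF xy(1)] gf(3)[OF xy(2)])
      moreover have "x = y" if "g x = g y"
        using arg_cong[OF that, of f] by (simp only: gf(3)[OF xy(1)] gf(3)[OF xy(2)])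
      ultimately show ?thesis by (cases "g x" "g y" rule: linorder_cases) auto
    qed
    have "g \<in> PLo_carrier b"
      unfolding PLo_carrier_def
    proof (intro CollectI conjI)
      show "g \<in> Bij ?I" unfolding g_def using fB by (rule restrict_inv_into_Bij)
      have "homeomorphism ?I ?I f' f" using hf by (rule homeomorphism_symD)
      then have "homeomorphism ?I ?I g f"
        by (rule homeomorphism_cong) (simp_all only: gf(1))
      then show "\<exists>f'. homeomorphism ?I ?I g f'" by (rule exI[of _ f])
      show "strict_mono_on ?I g" using less by (auto simp: strict_mono_on_def)
      obtain P where P: "finite P"
          "\<forall>x y. 0 \<le> x \<and> x \<le> y \<and> y \<le> b \<and> {x<..<y} \<inter> P = {} \<longrightarrow> (\<exists>m c. \<forall>t\<in>{x..y}. f t = m * t + c)"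
        using pl unfolding piecewise_linear_on_def by (elim exE conjE) (rule that)
      show "piecewise_linear_on 0 b g"
        unfolding piecewise_linear_on_def
      proof (intro exI[of _ "f ` P"] conjI allI impI)
        show "finite (f ` P)" using P by simp
        fix x y assume *: "0 \<le> x \<and> x \<le> y \<and> y \<le> b \<and> {x<..<y} \<inter> f ` P = {}"
        then have xy: "x \<in> ?I" "y \<in> ?I" by auto
        have le: "g s \<le> g t" if "s \<in> ?I" "t \<in> ?I" "s \<le> t" for s t
          using less[of t s] that by linarith
        have "{g x<..<g y} \<inter> P = {}"
        proof (rule ccontr)
          assume "{g x<..<g y} \<inter> P \<noteq> {}"
          then obtain p where p: "g x < p" "p < g y" "p \<in> P" by auto
          then have pI: "p \<in> ?I" using gf(2)[OF xy(1)] gf(2)[OF xy(2)] by auto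
          have "x < f p" "f p < y"
            using less[OF xy(1) fg(2)[OF pI]] less[OF fg(2)[OF pI] xy(2)] p(1,2)
            unfolding fg(1)[OF pI] by blast+
          with p(3) * show False by (metis IntI emptyE greaterThanLessThan_iff imageI)
        qed
        moreover have "0 \<le> g x" "g x \<le> g y" "g y \<le> b"
          using gf(2)[OF xy(1)] gf(2)[OF xy(2)] le[OF xy] * by simp_all
        ultimately have "\<exists>m c. \<forall>t\<in>{g x..g y}. f t = m * t + c"
          using P(2)[rule_format, of "g x" "g y"] by simp
        then obtain m c where mc: "\<And>t. t \<in> {g x..g y} \<Longrightarrow> f t = m * t + c"
          by blast
        show "\<exists>m c. \<forall>t\<in>{x..y}. g t = m * t + c"
        proof (cases "m = 0")
          case True
          have tx: "t = x" if "t \<in> {x..y}" for t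
          proof -
            have tI: "t \<in> ?I" using that * by auto
            have "g t \<in> {g x..g y}" "g x \<in> {g x..g y}"
              using that le[OF xy(1) tI] le[OF tI xy(2)] le[OF xy] * by auto
            then have "f (g t) = f (g x)" using mc True by simp
            then show ?thesis by (simp only: gf(3)[OF tI] gf(3)[OF xy(1)])
          qed
          have "\<forall>t\<in>{x..y}. g t = 0 * t + g x"
          proof
            fix t assume "t \<in> {x..y}"
            then show "g t = 0 * t + g x" using tx[of t] by simp
          qed
          then show ?thesis by blast
        next
          case False
          show ?thesis
          proof (rule exI[of _ "1/m"], rule exI[of _ "-c/m"], rule ballI)
            fix t assume t: "t \<in> {x..y}"
            then have tI: "t \<in> ?I" using * by auto
            have "g t \<in> {g x..g y}"
              using t le[OF xy(1) tI] le[OF tI xy(2)] by auto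
            then have "t = m * g t + c" using mc gf(3)[OF tI] by simp
            then show "g t = 1/m * t + -c/m" using False by (simp add: field_simps)
          qed
        qed
      qed
    qed
    moreover have "inv\<^bsub>BijGroup ?I\<^esub> f = g"
      using fB by (simp add: inv_BijGroup g_def)
    ultimately show "inv\<^bsub>BijGroup ?I\<^esub> f \<in> PLo_carrier b" by simp
  next
    fix f g assume f: "f \<in> PLo_carrier b" and g: "g \<in> PLo_carrier b"
    have fB: "f \<in> Bij ?I" "g \<in> Bij ?I" and sm: "strict_mono_on ?I f" "strict_mono_on ?I g"
      and pl: "piecewise_linear_on 0 b f" "piecewise_linear_on 0 b g"
      using f g unfolding PLo_carrier_def by blast+
    obtain f' where hf: "homeomorphism ?I ?I f f'" using f unfolding PLo_carrier_def by blast
    obtain g' where hg: "homeomorphism ?I ?I g g'" using g unfolding PLo_carrier_def by blast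
    have bij: "bij_betw f ?I ?I" "bij_betw g ?I ?I" using fB by (simp_all add: Bij_def)
    have gI: "g x \<in> ?I" if "x \<in> ?I" for x using bij that by (auto simp: bij_betw_def)
    have "compose ?I f g \<in> PLo_carrier b"
      unfolding PLo_carrier_def
    proof (intro CollectI conjI)
      show "compose ?I f g \<in> Bij ?I" using fB by (rule compose_Bij)
      have "homeomorphism ?I ?I (f \<circ> g) (g' \<circ> f')" using hg hf by (rule homeomorphism_compose)
      then have "homeomorphism ?I ?I (compose ?I f g) (g' \<circ> f')"
        by (rule homeomorphism_cong) (auto simp: compose_def)
      then show "\<exists>f'. homeomorphism ?I ?I (compose ?I f g) f'" by (rule exI[of _ "g' \<circ> f'"])
      show "strict_mono_on ?I (compose ?I f g)"
        unfolding strict_mono_on_def compose_def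
        using sm gI by (auto simp: strict_mono_on_def)
      obtain P where P: "finite P"
          "\<forall>x y. 0 \<le> x \<and> x \<le> y \<and> y \<le> b \<and> {x<..<y} \<inter> P = {} \<longrightarrow> (\<exists>m c. \<forall>t\<in>{x..y}. f t = m * t + c)"
        using pl(1) unfolding piecewise_linear_on_def by (elim exE conjE) (rule that)
      obtain Q where Q: "finite Q"
          "\<forall>x y. 0 \<le> x \<and> x \<le> y \<and> y \<le> b \<and> {x<..<y} \<inter> Q = {} \<longrightarrow> (\<exists>m c. \<forall>t\<in>{x..y}. g t = m * t + c)"
        using pl(2) unfolding piecewise_linear_on_def by (elim exE conjE) (rule that)
      show "piecewise_linear_on 0 b (compose ?I f g)"
        unfolding piecewise_linear_on_def
      proof (intro exI[of _ "Q \<union> inv_into ?I g ` P"] conjI allI impI)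
        show "finite (Q \<union> inv_into ?I g ` P)" using P Q by simp
        fix x y assume *: "0 \<le> x \<and> x \<le> y \<and> y \<le> b \<and> {x<..<y} \<inter> (Q \<union> inv_into ?I g ` P) = {}"
        then have xy: "x \<in> ?I" "y \<in> ?I" by auto
        have le: "g s \<le> g t" if "s \<in> ?I" "t \<in> ?I" "s \<le> t" for s t
          using strict_mono_onD[OF sm(2) that(1,2)] that(3) by (cases "s = t") auto
        have "{x<..<y} \<inter> Q = {}" using * by blast
        then have "\<exists>m c. \<forall>t\<in>{x..y}. g t = m * t + c"
          using Q(2)[rule_format, of x y] * by simp
        then obtain m c where mc: "\<And>t. t \<in> {x..y} \<Longrightarrow> g t = m * t + c"
          by blast
        have "{g x<..<g y} \<inter> P = {}"
        proof (rule ccontr)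
          assume "{g x<..<g y} \<inter> P \<noteq> {}"
          then obtain p where p: "g x < p" "p < g y" "p \<in> P" by auto
          then have "p \<in> ?I" using gI[OF xy(1)] gI[OF xy(2)] by auto
          then have "p \<in> g ` ?I" using bij_betw_imp_surj_on[OF bij(2)] by simp
          then obtain q where q: "q \<in> ?I" "p = g q" by (elim imageE) (rule that)
          then have "inv_into ?I g p = q"
            using inv_into_f_f[OF bij_betw_imp_inj_on[OF bij(2)] q(1)] by simp
          moreover have "x < q" "q < y"
            using p(1,2) q(2) le[OF q(1) xy(1)] le[OF xy(2) q(1)] by linarith+
          ultimately show False using p(3) * by (metis IntI UnI2 emptyE greaterThanLessThan_iff imageI)
        qed
        moreover have "0 \<le> g x" "g x \<le> g y" "g y \<le> b"
          using gI[OF xy(1)] gI[OF xy(2)] le[OF xy] * by simp_all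
        ultimately have "\<exists>m c. \<forall>t\<in>{g x..g y}. f t = m * t + c"
          using P(2)[rule_format, of "g x" "g y"] by simp
        then obtain m' c' where mc': "\<And>t. t \<in> {g x..g y} \<Longrightarrow> f t = m' * t + c'"
          by blast
        show "\<exists>m c. \<forall>t\<in>{x..y}. compose ?I f g t = m * t + c"
        proof (rule exI[of _ "m' * m"], rule exI[of _ "m' * c + c'"], rule ballI)
          fix t assume t: "t \<in> {x..y}"
          then have tI: "t \<in> ?I" using * by auto
          have "g t \<in> {g x..g y}" using t le[OF xy(1) tI] le[OF tI xy(2)] by auto
          then show "compose ?I f g t = m' * m * t + (m' * c + c')"
            using mc'[of "g t"] mc[OF t] tI by (simp add: compose_def algebra_simps)
        qed
      qed
    qed
    then show "f \<otimes>\<^bsub>BijGroup ?I\<^esub> g \<in> PLo_carrier b"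
      using fB by (simp add: BijGroup_def)
  qed
qed

lemma group_PLo: "group (PLo b)"
  unfolding PLo_def using group.subgroup_imp_group[OF group_BijGroup PLo_carrier_subgroup] .

text \<open>One-sided derivatives. The product is \<^const>\<open>compose\<close>, so both are multiplicative on the
  group, with positive values; hence the logarithms are homomorphisms into the additive group of
  the reals.\<close>

definition sigma_left :: "(real \<Rightarrow> real) \<Rightarrow> real" where
  "sigma_left g = vector_derivative g (at_right 0)"

definition sigma_right :: "real \<Rightarrow> (real \<Rightarrow> real) \<Rightarrow> real" where
  "sigma_right b g = vector_derivative g (at_left b)"

definition chi_left :: "(real \<Rightarrow> real) \<Rightarrow> real" where
  "chi_left g = ln (sigma_left g)"

definition chi_right :: "real \<Rightarrow> (real \<Rightarrow> real) \<Rightarrow> real" where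
  "chi_right b g = ln (sigma_right b g)"

definition real_additive_group :: "real monoid" where
  "real_additive_group = \<lparr>carrier = UNIV, mult = (+), one = 0\<rparr>"

definition positive_real_group :: "real monoid" where
  "positive_real_group = \<lparr>carrier = {0<..}, mult = (*), one = 1\<rparr>"

definition unit_group :: "real set \<Rightarrow> real set" where
  "unit_group B = {s. s \<noteq> 0 \<and> (\<lambda>x. s * x) ` B = B}"

definition torsion_group :: "('a, 'm) monoid_scheme \<Rightarrow> bool" where
  "torsion_group G \<longleftrightarrow> group G \<and> (\<forall>x\<in>carrier G. \<exists>n::nat. n > 0 \<and> x [^]\<^bsub>G\<^esub> n = \<one>\<^bsub>G\<^esub>)"

definition twisted_conjugacy_classes :: "('a, 'm) monoid_scheme \<Rightarrow> ('a \<Rightarrow> 'a) \<Rightarrow> 'a set set" where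
  "twisted_conjugacy_classes G \<alpha> =
     orbits G (carrier G) (\<lambda>g x. g \<otimes>\<^bsub>G\<^esub> x \<otimes>\<^bsub>G\<^esub> inv\<^bsub>G\<^esub> (\<alpha> g))"

definition property_R_infinity :: "('a, 'm) monoid_scheme \<Rightarrow> bool" where
  "property_R_infinity G \<longleftrightarrow> (\<forall>\<alpha>\<in>auto G. infinite (twisted_conjugacy_classes G \<alpha>))"

end

theory Submission
  imports Defs "HOL-Algebra.SndIsomorphismGrp" "HOL-Algebra.Generated_Groups"
begin

text \<open>The group acts on the open interval, and an element with trivial character \<open>\<chi>\<^sub>\<ell>\<close> is the
identity near \<open>0\<close>. If \<open>g\<close> contracts a neighbourhood of \<open>0\<close> towards \<open>0\<close>, that is, if
\<open>\<chi>\<^sub>\<ell>(g) < 0\<close>, then conjugation by \<open>g\<close> turns the group \<open>S\<close> of the elements that are the identity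
on that neighbourhood into a larger group of the same kind, and the groups \<open>g\<^sup>n S g\<^sup>-\<^sup>n\<close> exhaust
the kernel of \<open>\<chi>\<^sub>\<ell>\<close>. So this kernel is a strictly ascending union of conjugates of \<open>S\<close>, and this is
a property of the character that can be stated in the language of groups alone. It is called
\<open>exceptional\<close> below, and it is a concrete substitute for lying outside the
Bieri--Neumann--Strebel invariant. Composition with an automorphism preserves it
(\<open>exceptional_auto\<close>).

The core of the proof is that, up to positive factors, \<open>\<chi>\<^sub>\<ell>\<close> and \<open>\<chi>\<^sub>r\<close> are the only non-zero
exceptional characters (\<open>exceptional_L\<close>, \<open>exceptional_imp_proportional\<close>). Suppose that \<open>S\<close> is as
above for a character \<open>\<phi>\<close> and an element \<open>c\<close>. The group \<open>S\<close> contains every element of the kernel of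
\<open>\<phi>\<close> that commutes with \<open>c\<close>, or with \<open>c s\<close> for some \<open>s \<in> S\<close>. A commutator is the identity near both
end points. Hence, if the support of \<open>c\<close> can be pushed arbitrarily close to an end point by passing
from \<open>c\<close> to suitable \<open>c s\<close>, then all commutators lie in \<open>S\<close>. But then \<open>S\<close> is normal and equals the
whole kernel, so it was not a proper subgroup. Pushing is possible in two situations: if \<open>\<phi>\<close> is
negative on two elements with disjoint supports, one the identity near \<open>b\<close>, the other near \<open>0\<close> (\<open>opposite_supports\<close>), and
if \<open>\<phi>\<close> is negative on an element that is the identity near \<open>b\<close> and expands at \<open>0\<close>
(\<open>wrong_direction\<close>). Excluding both leaves only the multiples of \<open>\<chi>\<^sub>\<ell>\<close> and \<open>\<chi>\<^sub>r\<close>, because a power of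
every element is a product of elements of the two kernels.

An automorphism therefore sends \<open>\<chi>\<^sub>\<ell>\<close> to a positive multiple of \<open>\<chi>\<^sub>\<ell>\<close> or of \<open>\<chi>\<^sub>r\<close>. If the group of
units of the image of \<open>\<chi>\<^sub>\<ell>\<close> is \<open>{1, -1}\<close>, the factor is determined in both cases, so the orbit of
\<open>\<chi>\<^sub>\<ell>\<close> under the automorphism group has at most two elements. The sum over the orbit is an invariant
character (\<open>invariant_character_from_orbit\<close>); it is non-zero since the kernels of \<open>\<chi>\<^sub>\<ell>\<close> and \<open>\<chi>\<^sub>r\<close>
differ. The situation is symmetric in the two end points. Finally, an invariant character is
constant on every twisted conjugacy class and has an infinite image, whence property
\<open>R\<^sub>\<infinity>\<close>.\<close>

section \<open>Conjugation and real characters\<close>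

context group
begin

lemma inv_cancel:
  assumes "g \<in> carrier G" "x \<in> carrier G"
  shows "inv g \<otimes> (g \<otimes> x) = x" "g \<otimes> (inv g \<otimes> x) = x"
  using assms by (simp_all flip: m_assoc)

text \<open>Conjugation acts from the right, so that conjugating by \<open>g\<close> pulls sets of fixed points back
along \<open>g\<close>: an element fixing \<open>g(U)\<close> pointwise becomes one fixing \<open>U\<close>. A contraction \<open>g\<close> of \<open>U\<close>
then satisfies \<open>conjugate g ` S \<subseteq> S\<close> for the pointwise stabilizer \<open>S\<close> of \<open>U\<close>.\<close>

definition conjugate :: "'a \<Rightarrow> 'a \<Rightarrow> 'a" where
  "conjugate g x = inv g \<otimes> x \<otimes> g"

lemma conjugate_closed [simp]:
  "\<lbrakk>g \<in> carrier G; x \<in> carrier G\<rbrakk> \<Longrightarrow> conjugate g x \<in> carrier G"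
  by (simp add: conjugate_def)

lemma conjugate_mult:
  assumes "g \<in> carrier G" "h \<in> carrier G" "x \<in> carrier G"
  shows "conjugate (g \<otimes> h) x = conjugate h (conjugate g x)"
  using assms by (simp add: conjugate_def inv_mult_group m_assoc)

lemma conjugate_distrib:
  assumes "g \<in> carrier G" "x \<in> carrier G" "y \<in> carrier G"
  shows "conjugate g (x \<otimes> y) = conjugate g x \<otimes> conjugate g y"
  using assms by (simp add: conjugate_def m_assoc inv_cancel)

lemma conjugate_commuting:
  assumes "g \<in> carrier G" "x \<in> carrier G" "g \<otimes> x = x \<otimes> g"
  shows "conjugate g x = x"
  using assms(1,2) by (simp add: conjugate_def m_assoc inv_cancel(1) flip: assms(3))

lemma commute_nat_pow:
  assumes "x \<otimes> y = y \<otimes> x" "x \<in> carrier G" "y \<in> carrier G"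
  shows "x [^] (n::nat) \<otimes> y = y \<otimes> x [^] n"
proof (induction n)
  case (Suc n)
  have "x [^] Suc n \<otimes> y = x [^] n \<otimes> y \<otimes> x" using assms by (simp add: m_assoc)
  also have "\<dots> = y \<otimes> x [^] Suc n" using assms(2,3) by (simp only: Suc) (simp add: m_assoc)
  finally show ?case .
qed (use assms in simp)

abbreviation characters :: "('a \<Rightarrow> real) set" where
  "characters \<equiv> hom G real_additive_group"

abbreviation ker :: "('a \<Rightarrow> real) \<Rightarrow> 'a set" where
  "ker \<phi> \<equiv> kernel G real_additive_group \<phi>"

lemma ker_iff: "x \<in> ker \<phi> \<longleftrightarrow> x \<in> carrier G \<and> \<phi> x = 0"
  by (simp add: kernel_def real_additive_group_def)

lemma character_mult:
  "\<lbrakk>\<phi> \<in> characters; x \<in> carrier G; y \<in> carrier G\<rbrakk> \<Longrightarrow> \<phi> (x \<otimes> y) = \<phi> x + \<phi> y"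
  by (auto simp: hom_def real_additive_group_def)

lemma character_one: "\<phi> \<in> characters \<Longrightarrow> \<phi> \<one> = 0"
  using character_mult[of \<phi> \<one> \<one>] by simp

lemma character_inv:
  assumes "\<phi> \<in> characters" "x \<in> carrier G"
  shows "\<phi> (inv x) = - \<phi> x"
  using character_mult[of \<phi> x "inv x"] character_one[of \<phi>] assms by simp

lemma character_conjugate:
  assumes "\<phi> \<in> characters" "g \<in> carrier G" "x \<in> carrier G"
  shows "\<phi> (conjugate g x) = \<phi> x"
  using assms by (simp add: conjugate_def character_mult character_inv)

lemma character_pow:
  assumes "\<phi> \<in> characters" "x \<in> carrier G"
  shows "\<phi> (x [^] (n::nat)) = n * \<phi> x"
  using assms by (induction n) (simp_all add: character_one character_mult algebra_simps)

lemma character_int_pow: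
  assumes "\<phi> \<in> characters" "x \<in> carrier G"
  shows "\<phi> (x [^] (n::int)) = n * \<phi> x"
proof (cases n rule: int_cases2)
  case (nonneg m)
  then show ?thesis using character_pow[OF assms, of m] by (simp add: int_pow_int)
next
  case (nonpos m)
  then show ?thesis
    using character_pow[OF assms, of m] character_inv[OF assms(1) nat_pow_closed[OF assms(2)], of m]
      int_pow_neg_int[OF assms(2), of m]
    by simp
qed

lemma character_add:
  assumes "\<phi> \<in> characters" "\<psi> \<in> characters"
  shows "(\<lambda>x. \<phi> x + \<psi> x) \<in> characters"
  using assms by (auto simp: hom_def real_additive_group_def)

lemma character_auto:
  assumes "\<phi> \<in> characters" "\<alpha> \<in> iso G G"
  shows "\<phi> \<circ> \<alpha> \<in> characters"
  using assms Group.hom_compose[of \<alpha> G G \<phi>] by (simp add: iso_def)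

lemma ker_normal:
  assumes "\<phi> \<in> characters"
  shows "ker \<phi> \<lhd> G"
proof -
  have "group real_additive_group"
    by (rule groupI) (auto simp: real_additive_group_def intro: exI[of _ "- _"])
  then interpret group_hom G real_additive_group \<phi>
    using assms by (simp add: group_hom_def group_hom_axioms_def is_group)
  show ?thesis by (rule normal_kernel)
qed

lemma ker_subgroup: "\<phi> \<in> characters \<Longrightarrow> subgroup (ker \<phi>) G"
  using ker_normal normal_imp_subgroup by blast

text \<open>A homomorphism between subgroups of the reals that respects the sign is multiplication by a
constant. Here the homomorphism is \<open>\<mu>(c) \<mapsto> \<phi>(c)\<close>, with
constant \<open>s = \<phi>(a)/\<mu>(a)\<close>; if \<open>\<phi>(c) < s \<mu>(c)\<close>, then the sign condition would fail at a
combination \<open>c\<^sup>n a\<^sup>-\<^sup>m\<close> with \<open>m/n\<close> just below \<open>\<mu>(c)/\<mu>(a)\<close>.\<close>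

lemma character_proportional:
  assumes \<phi>: "\<phi> \<in> characters" and \<mu>: "\<mu> \<in> characters" and K: "subgroup K G"
    and neg: "\<And>c. \<lbrakk>c \<in> K; \<phi> c < 0\<rbrakk> \<Longrightarrow> \<mu> c < 0"
  shows "\<exists>s\<ge>0. \<forall>c\<in>K. \<phi> c = s * \<mu> c"
proof -
  have inK: "x \<in> carrier G" "inv x \<in> K" if "x \<in> K" for x
    using K that by (auto simp: subgroup.mem_carrier subgroup.m_inv_closed)
  show ?thesis
  proof (cases "\<exists>a\<in>K. \<mu> a \<noteq> 0")
    case False
    have "\<phi> c = 0" if "c \<in> K" for c
      using neg[of c] neg[of "inv c"] False that inK[OF that] character_inv[OF \<phi>, of c] by force
    then show ?thesis by (intro exI[of _ 0]) simp
  next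
    case True
    then obtain a where a: "a \<in> K" "\<mu> a > 0"
      by (metis character_inv[OF \<mu>] inK neg_0_less_iff_less linorder_neqE_linordered_idom)
    have \<phi>a: "\<phi> a \<ge> 0" using neg[of a] a by force
    define s where "s = \<phi> a / \<mu> a"
    have s: "s \<ge> 0" "\<phi> a = s * \<mu> a" using a \<phi>a by (simp_all add: s_def)
    have le: "\<phi> c \<ge> s * \<mu> c" if c: "c \<in> K" for c
    proof (rule ccontr)
      assume "\<not> \<phi> c \<ge> s * \<mu> c"
      then obtain n :: nat where n: "\<phi> a < real n * (s * \<mu> c - \<phi> c)"
        using ex_less_of_nat_mult[of "s * \<mu> c - \<phi> c" "\<phi> a"] by auto
      \<comment> \<open>The largest \<open>m\<close> for which \<open>\<mu>\<close> stays non-negative on \<open>c\<^sup>n a\<^sup>-\<^sup>m\<close>; the size of \<open>n\<close> absorbs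
        the rounding error.\<close>
      define m :: int where "m = \<lfloor>real n * \<mu> c / \<mu> a\<rfloor>"
      have m: "m * \<mu> a \<le> n * \<mu> c" "n * \<mu> c < m * \<mu> a + \<mu> a"
        using a(2) floor_divide_lower[of "\<mu> a" "n * \<mu> c"] floor_divide_upper[of "\<mu> a" "n * \<mu> c"]
        by (auto simp: m_def algebra_simps)
      let ?x = "c [^] n \<otimes> inv (a [^] m)"
      have x: "?x \<in> K" using K a(1) c
        by (intro subgroup.m_closed[OF K] subgroup.m_inv_closed[OF K] subgroup_int_pow_closed
            subgroup_int_pow_closed[of K c "int n", unfolded int_pow_int])
      have val: "\<theta> ?x = n * \<theta> c - m * \<theta> a" if "\<theta> \<in> characters" for \<theta> :: "'a \<Rightarrow> real"
        using inK(1)[OF a(1)] inK(1)[OF c]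
        by (simp add: character_mult[OF that] character_inv[OF that] character_pow[OF that]
            character_int_pow[OF that])
      have "s * (n * \<mu> c) \<le> s * (m * \<mu> a + \<mu> a)"
        using m(2) s(1) by (intro mult_left_mono) auto
      then have "\<phi> ?x < 0" using n s(2) by (simp add: val[OF \<phi>] algebra_simps)
      from neg[OF x this] m(1) show False by (simp add: val[OF \<mu>])
    qed
    have "\<phi> c = s * \<mu> c" if "c \<in> K" for c
      using le[OF that] le[of "inv c"] inK[OF that] \<phi> \<mu> by (simp add: character_inv)
    with s(1) show ?thesis by blast
  qed
qed

end

section \<open>Exceptional characters\<close>

context group
begin

text \<open>The groups \<open>g\<^sup>n S g\<^sup>-\<^sup>n\<close> form an ascending chain whose union contains \<open>N\<close>.\<close>

definition absorbs :: "'a \<Rightarrow> 'a set \<Rightarrow> 'a set \<Rightarrow> bool" where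
  "absorbs g N S \<longleftrightarrow>
     (\<forall>x\<in>S. conjugate g x \<in> S) \<and> (\<forall>k\<in>N. \<exists>n::nat. conjugate (g [^] n) k \<in> S)"

text \<open>One subgroup \<open>S\<close> has to serve two elements at once. The values \<open>\<phi> c\<close> and \<open>\<phi> d\<close> may be
incommensurable, so that no power of \<open>c\<close> agrees with a power of \<open>d\<close> modulo the kernel, and
a subgroup chosen for \<open>c\<close> alone need not contain the elements of the kernel that commute with
\<open>d\<close>.\<close>

definition exceptional :: "('a \<Rightarrow> real) \<Rightarrow> bool" where
  "exceptional \<phi> \<longleftrightarrow>
     (\<forall>c\<in>carrier G. \<forall>d\<in>carrier G. \<phi> c < 0 \<and> \<phi> d < 0 \<longrightarrow>
        (\<exists>S. subgroup S G \<and> S \<subset> ker \<phi> \<and> absorbs c (ker \<phi>) S \<and> absorbs d (ker \<phi>) S))"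

text \<open>An element commuting with \<open>c s\<close> is fixed under conjugation by every power of \<open>c s\<close>. These
conjugations agree with those by the powers of \<open>c\<close> up to conjugation by elements of \<open>S\<close>, so they
too move every element of \<open>N\<close> into \<open>S\<close> eventually.\<close>

lemma absorbs_commuting:
  assumes abs: "absorbs c N S" and S: "subgroup S G" and c: "c \<in> carrier G" and s: "s \<in> S"
    and k: "k \<in> N" "k \<in> carrier G" and comm: "k \<otimes> (c \<otimes> s) = c \<otimes> s \<otimes> k"
  shows "k \<in> S"
proof -
  have SG: "x \<in> carrier G" if "x \<in> S" for x using S that by (rule subgroup.mem_carrier)
  have pow: "\<exists>t\<in>S. (c \<otimes> s) [^] n = c [^] n \<otimes> t" for n :: nat
  proof (induction n)
    case 0
    show ?case using subgroup.one_closed[OF S] by (intro bexI[of _ \<one>]) auto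
  next
    case (Suc n)
    then obtain t where t: "t \<in> S" "(c \<otimes> s) [^] n = c [^] n \<otimes> t" by blast
    have "(c \<otimes> s) [^] Suc n = c [^] Suc n \<otimes> (conjugate c t \<otimes> s)"
      using t c SG[OF s] SG[OF t(1)] by (simp add: conjugate_def m_assoc inv_cancel)
    moreover have "conjugate c t \<otimes> s \<in> S"
      using abs t(1) s S by (auto simp: absorbs_def intro: subgroup.m_closed)
    ultimately show ?case by blast
  qed
  obtain n :: nat where n: "conjugate (c [^] n) k \<in> S" using abs k by (auto simp: absorbs_def)
  obtain t where t: "t \<in> S" "(c \<otimes> s) [^] n = c [^] n \<otimes> t" using pow by blast
  have "(c \<otimes> s) [^] n \<otimes> k = k \<otimes> (c \<otimes> s) [^] n"
    using comm c SG[OF s] k by (intro commute_nat_pow) auto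
  then have "k = conjugate ((c \<otimes> s) [^] n) k"
    using c SG[OF s] k by (intro conjugate_commuting[symmetric]) auto
  also have "\<dots> = conjugate t (conjugate (c [^] n) k)"
    using t c SG[OF t(1)] k by (simp add: conjugate_mult)
  also have "\<dots> \<in> S" unfolding conjugate_def[of t]
    using t(1) n S by (auto intro: subgroup.m_closed subgroup.m_inv_closed)
  finally show ?thesis .
qed

lemma absorbs_centralizer:
  assumes "absorbs c N S" "subgroup S G" "c \<in> carrier G"
    and "k \<in> N" "k \<in> carrier G" "k \<otimes> c = c \<otimes> k"
  shows "k \<in> S"
  using absorbs_commuting[OF assms(1-3) subgroup.one_closed[OF assms(2)] assms(4,5)]
  unfolding r_one[OF assms(3)] using assms(6) .

lemma absorbs_pow_mono:
  assumes "absorbs c N S" "c \<in> carrier G" "k \<in> carrier G" "conjugate (c [^] n) k \<in> S" "(n::nat) \<le> m"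
  shows "conjugate (c [^] m) k \<in> S"
  using assms(5)
proof (induction rule: dec_induct)
  case base
  show ?case by (rule assms(4))
next
  case (step m)
  then show ?case using assms(1-3) by (simp add: conjugate_mult absorbs_def)
qed

text \<open>The quotient of \<open>k\<close> and a conjugate of \<open>k\<close> is a commutator, and some conjugate of \<open>k\<close> lies in
\<open>S\<close>.\<close>

lemma absorbs_commutators:
  assumes abs: "absorbs c N S" and S: "subgroup S G" and c: "c \<in> carrier G" and N: "N \<subseteq> carrier G"
    and comm: "\<And>x y. \<lbrakk>x \<in> carrier G; y \<in> carrier G\<rbrakk> \<Longrightarrow> x \<otimes> y \<otimes> inv x \<otimes> inv y \<in> S"
  shows "N \<subseteq> S"
proof
  fix k assume k: "k \<in> N"
  with N have kG: "k \<in> carrier G" by blast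
  obtain n :: nat where n: "conjugate (c [^] n) k \<in> S" using abs k by (auto simp: absorbs_def)
  have "k = conjugate (c [^] n) k \<otimes> (inv (c [^] n) \<otimes> inv k \<otimes> inv (inv (c [^] n)) \<otimes> inv (inv k))"
    using c kG by (simp add: conjugate_def m_assoc inv_cancel)
  moreover have "\<dots> \<in> S"
    by (rule subgroup.m_closed[OF S n], rule comm) (use c kG in auto)
  ultimately show "k \<in> S" by simp
qed

lemma exceptional_auto:
  assumes exc: "exceptional \<phi>" and \<alpha>: "\<alpha> \<in> iso G G"
  shows "exceptional (\<phi> \<circ> \<alpha>)"
  unfolding exceptional_def
proof (intro ballI impI)
  fix c d assume cd: "c \<in> carrier G" "d \<in> carrier G" "(\<phi> \<circ> \<alpha>) c < 0 \<and> (\<phi> \<circ> \<alpha>) d < 0"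
  interpret \<alpha>: group_hom G G \<alpha>
    using \<alpha> by (simp add: group_hom_def group_hom_axioms_def iso_def is_group)
  have bij: "bij_betw \<alpha> (carrier G) (carrier G)" using \<alpha> by (simp add: iso_def)
  obtain S where S: "subgroup S G" "S \<subset> ker \<phi>" "absorbs (\<alpha> c) (ker \<phi>) S" "absorbs (\<alpha> d) (ker \<phi>) S"
    using exc[unfolded exceptional_def, rule_format, of "\<alpha> c" "\<alpha> d"] cd by auto
  let ?T = "{x \<in> carrier G. \<alpha> x \<in> S}"
  have \<alpha>_conj: "\<alpha> (conjugate g x) = conjugate (\<alpha> g) (\<alpha> x)" if "g \<in> carrier G" "x \<in> carrier G" for g x
    using that by (simp add: conjugate_def)
  have ker: "x \<in> ker (\<phi> \<circ> \<alpha>) \<longleftrightarrow> x \<in> carrier G \<and> \<alpha> x \<in> ker \<phi>" for x by (auto simp: ker_iff)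
  have abs: "absorbs g (ker (\<phi> \<circ> \<alpha>)) ?T" if "absorbs (\<alpha> g) (ker \<phi>) S" "g \<in> carrier G" for g
    using that by (auto simp: absorbs_def ker \<alpha>_conj \<alpha>.hom_nat_pow)
  have "\<one> \<in> ?T" using subgroup.one_closed[OF S(1)] by simp
  then have "subgroup ?T G"
    using S(1) by (intro subgroupI) (auto simp: subgroup.m_closed subgroup.m_inv_closed)
  moreover have "?T \<subset> ker (\<phi> \<circ> \<alpha>)"
  proof -
    obtain y where y: "y \<in> ker \<phi>" "y \<notin> S" using S(2) by blast
    then obtain x where "x \<in> carrier G" "\<alpha> x = y"
      using bij unfolding ker_iff bij_betw_def by (metis imageE)
    then show ?thesis using y S(2) ker by blast
  qed
  ultimately show "\<exists>S. subgroup S G \<and> S \<subset> ker (\<phi> \<circ> \<alpha>) \<and> absorbs c (ker (\<phi> \<circ> \<alpha>)) S \<and> absorbs d (ker (\<phi> \<circ> \<alpha>)) S"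
    using abs S cd by blast
qed

end

section \<open>Pointwise stabilizers in a faithful action\<close>

locale faithful_action = group G for G (structure) +
  fixes X :: "'x set" and act :: "'a \<Rightarrow> 'x \<Rightarrow> 'x"
  assumes act_closed: "\<lbrakk>g \<in> carrier G; x \<in> X\<rbrakk> \<Longrightarrow> act g x \<in> X"
    and act_one: "x \<in> X \<Longrightarrow> act \<one> x = x"
    and act_mult: "\<lbrakk>g \<in> carrier G; h \<in> carrier G; x \<in> X\<rbrakk> \<Longrightarrow> act (g \<otimes> h) x = act g (act h x)"
    and act_faithful: "\<lbrakk>g \<in> carrier G; h \<in> carrier G; \<And>x. x \<in> X \<Longrightarrow> act g x = act h x\<rbrakk> \<Longrightarrow> g = h"
begin

lemma act_inv:
  assumes "g \<in> carrier G" "x \<in> X"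
  shows "act (inv g) (act g x) = x" "act g (act (inv g) x) = x"
  using assms by (simp_all add: act_one flip: act_mult)

lemma act_image_mult:
  assumes "g \<in> carrier G" "h \<in> carrier G" "U \<subseteq> X"
  shows "act (g \<otimes> h) ` U = act g ` act h ` U"
  using assms by (force simp: image_image act_mult subset_iff intro!: image_cong)

lemma act_image_inv:
  assumes "g \<in> carrier G" "U \<subseteq> X"
  shows "act (inv g) ` act g ` U = U"
  using assms act_inv by (force simp: image_image subset_iff)

lemma act_image_subset:
  assumes "g \<in> carrier G" "U \<subseteq> X"
  shows "act g ` U \<subseteq> X"
  using assms act_closed by blast

definition fixer :: "'x set \<Rightarrow> 'a set" where
  "fixer U = {g \<in> carrier G. \<forall>x\<in>U. act g x = x}"

lemma fixer_carrier: "g \<in> fixer U \<Longrightarrow> g \<in> carrier G"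
  by (simp add: fixer_def)

lemma fixer_antimono: "U \<subseteq> V \<Longrightarrow> fixer V \<subseteq> fixer U"
  by (auto simp: fixer_def)

lemma fixer_subgroup:
  assumes "U \<subseteq> X"
  shows "subgroup (fixer U) G"
proof (rule subgroupI)
  have "\<one> \<in> fixer U" using assms by (auto simp: fixer_def act_one)
  then show "fixer U \<noteq> {}" by blast
  show "inv g \<in> fixer U" if "g \<in> fixer U" for g
    using that assms act_inv(1)[of g] by (force simp: fixer_def)
  show "g \<otimes> h \<in> fixer U" if "g \<in> fixer U" "h \<in> fixer U" for g h
    using that assms by (auto simp: fixer_def act_mult)
qed (auto simp: fixer_def)

lemma conjugate_in_fixer_iff:
  assumes "g \<in> carrier G" "x \<in> carrier G" "U \<subseteq> X"
  shows "conjugate g x \<in> fixer U \<longleftrightarrow> x \<in> fixer (act g ` U)"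
proof -
  have "act (conjugate g x) u = u \<longleftrightarrow> act x (act g u) = act g u" if "u \<in> U" for u
  proof -
    have u: "u \<in> X" using that assms by blast
    then have "act (conjugate g x) u = act (inv g) (act x (act g u))"
      using assms by (simp add: conjugate_def act_mult act_closed)
    then show ?thesis
      using u assms act_inv act_closed by (metis inv_closed)
  qed
  then show ?thesis using assms by (auto simp: fixer_def)
qed

lemma fixers_commute:
  assumes "g \<in> fixer U" "h \<in> fixer V" "U \<union> V = X"
  shows "g \<otimes> h = h \<otimes> g"
proof -
  have G: "g \<in> carrier G" "h \<in> carrier G" using assms by (auto simp: fixer_def)
  have one: "act a (act c x) = act c (act a x)"
    if "a \<in> fixer A" "c \<in> fixer C" "A \<union> C = X" "x \<in> A" for a c A C x
  proof -
    have x: "x \<in> X" "a \<in> carrier G" "c \<in> carrier G" "act a x = x"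
      using that by (auto simp: fixer_def)
    \<comment> \<open>If \<open>c\<close> carries \<open>x\<close> into its own set of fixed points, then it fixes \<open>x\<close>.\<close>
    have "act c x \<in> A \<or> act c x = x"
    proof (cases "act c x \<in> C")
      case True
      then have "act c (act c x) = act c x" using that by (simp add: fixer_def)
      then show ?thesis using x act_inv(1) act_closed by metis
    next
      case False
      then show ?thesis using act_closed[of c x] x that(3) by blast
    qed
    then show ?thesis using that(1) x by (auto simp: fixer_def)
  qed
  show ?thesis
  proof (rule act_faithful)
    fix x assume x: "x \<in> X"
    have "act g (act h x) = act h (act g x)"
      using one[OF assms, of x] one[OF assms(2,1), of x] assms(3) x by (metis Un_commute Un_iff)
    then show "act (g \<otimes> h) x = act (h \<otimes> g) x" using G x by (simp add: act_mult)
  qed (use G in auto)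
qed

end

section \<open>Actions with two ends\<close>

text \<open>An end of the space \<open>X\<close>, described by a chain \<open>E\<close> of neighbourhoods with empty intersection;
\<open>L\<close> is the logarithm of the derivative at the end. The condition \<open>contracting\<close> says that an element
with negative \<open>L\<close> attracts a whole neighbourhood of the end. Keeping the end abstract makes the
argument applicable to \<open>0\<close> and to \<open>b\<close> without reflecting the interval.\<close>

locale action_end = faithful_action G X act for G (structure) and X :: "'x set" and act +
  fixes E :: "'x set set" and L :: "'a \<Rightarrow> real"
  assumes nbhd_subset: "U \<in> E \<Longrightarrow> U \<subseteq> X"
    and nbhd_chain: "\<lbrakk>U \<in> E; V \<in> E\<rbrakk> \<Longrightarrow> U \<subseteq> V \<or> V \<subseteq> U"
    and nbhd_image: "\<lbrakk>g \<in> carrier G; U \<in> E\<rbrakk> \<Longrightarrow> act g ` U \<in> E"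
    and nbhd_avoid: "x \<in> X \<Longrightarrow> \<exists>U\<in>E. x \<notin> U"
    and L_character: "L \<in> characters"
    and L_zero_iff: "g \<in> carrier G \<Longrightarrow> L g = 0 \<longleftrightarrow> (\<exists>U\<in>E. g \<in> fixer U)"
    and contracting: "\<lbrakk>g \<in> carrier G; L g < 0\<rbrakk> \<Longrightarrow>
      \<exists>U\<in>E. (\<forall>V\<in>E. V \<subseteq> U \<longrightarrow> act g ` V \<subseteq> V) \<and> (\<forall>V\<in>E. \<exists>n::nat. act (g [^] n) ` U \<subseteq> V)"
begin

lemma fixer_nbhd_subset_ker: "U \<in> E \<Longrightarrow> fixer U \<subseteq> ker L"
  using L_zero_iff fixer_carrier unfolding ker_iff subset_iff by metis

lemma contracting_eventually:
  assumes "g \<in> carrier G" "U \<in> E" "act g ` U \<subseteq> U" "act (g [^] n) ` U \<subseteq> V" "(n::nat) \<le> m"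
  shows "act (g [^] m) ` U \<subseteq> V"
  using assms(5)
proof (induction rule: dec_induct)
  case base
  show ?case by (rule assms(4))
next
  case (step m)
  have "act (g [^] Suc m) ` U = act (g [^] m) ` act g ` U"
    using assms(1) nbhd_subset[OF assms(2)] by (simp add: act_image_mult)
  also have "\<dots> \<subseteq> V" using step.IH assms(3) by blast
  finally show ?case .
qed

lemma absorbs_fixer:
  assumes g: "g \<in> carrier G" and U: "U \<in> E" and sub: "act g ` U \<subseteq> U"
    and exhaust: "\<And>V. V \<in> E \<Longrightarrow> \<exists>n::nat. act (g [^] n) ` U \<subseteq> V"
  shows "absorbs g (ker L) (fixer U)"
  unfolding absorbs_def
proof (intro conjI ballI)
  fix x assume "x \<in> fixer U"
  then show "conjugate g x \<in> fixer U"
    using conjugate_in_fixer_iff[OF g _ nbhd_subset[OF U]] fixer_antimono[OF sub]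
    by (auto simp: fixer_def)
next
  fix k assume "k \<in> ker L"
  then obtain V where V: "V \<in> E" "k \<in> fixer V" and k: "k \<in> carrier G"
    using L_zero_iff by (auto simp: ker_iff)
  obtain n :: nat where "act (g [^] n) ` U \<subseteq> V" using exhaust[OF V(1)] by blast
  then have "conjugate (g [^] n) k \<in> fixer U"
    using conjugate_in_fixer_iff[OF _ k nbhd_subset[OF U]] g fixer_antimono V(2) by blast
  then show "\<exists>n::nat. conjugate (g [^] n) k \<in> fixer U" by blast
qed

end

text \<open>The condition \<open>cover\<close> says that the complement of a neighbourhood of one end can be moved into
any given neighbourhood of the other end. For an interval it expresses that the group has no fixed
point. All conditions together are symmetric in the two ends, see \<open>swap\<close>.\<close>

locale two_ends =
  faithful_action G X act + left: action_end G X act E L + right: action_end G X act F R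
  for G (structure) and X :: "'x set" and act E L F R +
  assumes cover: "\<lbrakk>U \<in> E; V \<in> F\<rbrakk> \<Longrightarrow> \<exists>g\<in>carrier G. U \<union> act g ` V = X"
    and L_nonzero: "\<exists>g\<in>carrier G. L g \<noteq> 0"
    and R_nonzero: "\<exists>g\<in>carrier G. R g \<noteq> 0"
    and virtually_product: "g \<in> carrier G \<Longrightarrow> \<exists>n>0. \<exists>u\<in>ker L. \<exists>v\<in>ker R. g [^] (n::nat) = u \<otimes> v"
begin

lemma cover_right:
  assumes "U \<in> E" "V \<in> F"
  shows "\<exists>g\<in>carrier G. V \<union> act g ` U = X"
proof -
  obtain g where g: "g \<in> carrier G" "U \<union> act g ` V = X" using cover assms by blast
  have UV: "U \<subseteq> X" "V \<subseteq> X" using left.nbhd_subset right.nbhd_subset assms by auto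
  have "V \<union> act (inv g) ` U = act (inv g) ` (act g ` V \<union> U)"
    using act_image_inv[OF g(1) UV(2)] by (simp add: image_Un)
  also have "\<dots> = act (inv g) ` X" using g(2) by (simp add: Un_commute)
  also have "\<dots> = X"
  proof
    show "act (inv g) ` X \<subseteq> X" using act_image_subset g(1) by simp
    show "X \<subseteq> act (inv g) ` X"
      using g(1) act_inv(1)[OF g(1)] act_closed[OF g(1)] by (metis image_eqI subsetI)
  qed
  finally show ?thesis using g(1) by (intro bexI[of _ "inv g"]) simp_all
qed

lemma swap: "two_ends G X act F R E L"
proof (unfold_locales)
  show "\<exists>g\<in>carrier G. U \<union> act g ` V = X" if "U \<in> F" "V \<in> E" for U V
    using cover_right[OF that(2,1)] .
  show "\<exists>n>0. \<exists>u\<in>ker R. \<exists>v\<in>ker L. g [^] (n::nat) = u \<otimes> v" if g: "g \<in> carrier G" for g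
  proof -
    obtain n :: nat and u v where *: "n > 0" "u \<in> ker L" "v \<in> ker R" "g [^] n = u \<otimes> v"
      using virtually_product[OF g] by blast
    then have uv: "u \<in> carrier G" "v \<in> carrier G" by (auto simp: ker_iff)
    then have "conjugate v u \<in> ker L" "g [^] n = v \<otimes> conjugate v u"
      using * by (auto simp: ker_iff character_conjugate[OF left.L_character])
        (simp add: conjugate_def m_assoc inv_cancel)
    with * show ?thesis by blast
  qed
qed (rule R_nonzero L_nonzero)+

text \<open>A power of an element with \<open>L \<noteq> 0\<close> is a product \<open>u v\<close> with \<open>L(u) = 0\<close> and \<open>R(v) = 0\<close>, so \<open>L(v)\<close>
is non-zero.\<close>

lemma ex_ker_R_neg:
  "\<exists>c\<in>ker R. L c < 0"
proof -
  obtain g where g: "g \<in> carrier G" "L g \<noteq> 0" using L_nonzero by blast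
  obtain n :: nat and u v where *: "n > 0" "u \<in> ker L" "v \<in> ker R" "g [^] n = u \<otimes> v"
    using virtually_product[OF g(1)] by blast
  have uv: "u \<in> carrier G" "L u = 0" "v \<in> carrier G" "R v = 0" using * by (auto simp: ker_iff)
  have "n * L g = L v"
    using character_pow[OF left.L_character g(1), of n] *(4) uv
      character_mult[OF left.L_character uv(1,3)] by simp
  then have "L v \<noteq> 0" using g(2) *(1) by auto
  then have "L v < 0 \<or> L (inv v) < 0" using character_inv[OF left.L_character uv(3)] by linarith
  moreover have "inv v \<in> ker R"
    using uv character_inv[OF right.L_character uv(3)] by (simp add: ker_iff)
  ultimately show ?thesis using *(3) by blast
qed

text \<open>The pointwise stabilizer of a small neighbourhood \<open>U\<close> of the left end is absorbing for
contractions. It is a proper subgroup of the kernel of \<open>L\<close>: otherwise, the kernel being normal, its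
elements would be the identity on all translates of \<open>U\<close>, which cover the space, whereas the kernel
contains an element with \<open>R \<noteq> 0\<close>.\<close>

lemma exceptional_L: "exceptional L"
  unfolding exceptional_def
proof (intro ballI impI)
  fix c d assume cd: "c \<in> carrier G" "d \<in> carrier G" "L c < 0 \<and> L d < 0"
  have ex: "\<exists>U\<in>E. \<forall>V\<in>E. V \<subseteq> U \<longrightarrow> absorbs g (ker L) (fixer V)"
    if g: "g \<in> carrier G" "L g < 0" for g
  proof -
    obtain U where U: "U \<in> E" "\<forall>V\<in>E. V \<subseteq> U \<longrightarrow> act g ` V \<subseteq> V"
        "\<forall>V\<in>E. \<exists>n::nat. act (g [^] n) ` U \<subseteq> V"
      using left.contracting[OF g] by blast
    have "absorbs g (ker L) (fixer V)" if V: "V \<in> E" "V \<subseteq> U" for V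
    proof (rule left.absorbs_fixer[OF g(1) V(1)])
      show "act g ` V \<subseteq> V" using U(2) V by blast
      show "\<exists>n::nat. act (g [^] n) ` V \<subseteq> W" if "W \<in> E" for W
        using U(3) that image_mono[OF V(2)] by (meson order_trans)
    qed
    with U(1) show ?thesis by blast
  qed
  obtain U1 where U1: "U1 \<in> E" "\<forall>V\<in>E. V \<subseteq> U1 \<longrightarrow> absorbs c (ker L) (fixer V)"
    using ex cd by blast
  obtain U2 where U2: "U2 \<in> E" "\<forall>V\<in>E. V \<subseteq> U2 \<longrightarrow> absorbs d (ker L) (fixer V)"
    using ex cd by blast
  obtain U where U: "U \<in> E" "U \<subseteq> U1" "U \<subseteq> U2"
    using left.nbhd_chain[OF U1(1) U2(1)] U1(1) U2(1) by blast
  have "fixer U \<noteq> ker L"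
  proof
    assume eq: "fixer U = ker L"
    obtain h where h: "h \<in> ker L" "R h < 0" using two_ends.ex_ker_R_neg[OF swap] by blast
    then have hG: "h \<in> carrier G" by (simp add: ker_iff)
    have "act h x = x" if x: "x \<in> X" for x
    proof -
      obtain V where V: "V \<in> F" "x \<notin> V" using right.nbhd_avoid[OF x] by blast
      obtain g where g: "g \<in> carrier G" "V \<union> act g ` U = X" using cover_right[OF U(1) V(1)] by blast
      have "conjugate g h \<in> fixer U"
        using h(1) eq g(1) character_conjugate[OF left.L_character] by (simp add: ker_iff)
      then have "h \<in> fixer (act g ` U)"
        using conjugate_in_fixer_iff[OF g(1) hG left.nbhd_subset[OF U(1)]] by simp
      moreover have "x \<in> act g ` U" using g(2) V(2) x by blast
      ultimately show ?thesis by (auto simp: fixer_def)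
    qed
    then have "h = \<one>" using hG by (intro act_faithful) (auto simp: act_one)
    then show False using h(2) character_one[OF right.L_character] by simp
  qed
  then show "\<exists>S. subgroup S G \<and> S \<subset> ker L \<and> absorbs c (ker L) S \<and> absorbs d (ker L) S"
    using U U1 U2 fixer_subgroup[OF left.nbhd_subset[OF U(1)]] left.fixer_nbhd_subset_ker[OF U(1)]
    by (intro exI[of _ "fixer U"]) auto
qed

lemma character_commutator:
  assumes "\<phi> \<in> characters" "x \<in> carrier G" "y \<in> carrier G"
  shows "\<phi> (x \<otimes> y \<otimes> inv x \<otimes> inv y) = 0"
  using assms by (simp add: character_mult[OF assms(1)] character_inv[OF assms(1)])

lemma fixer_conjugate:
  assumes "c \<in> fixer V" "g \<in> carrier G" "V \<subseteq> X"
  shows "conjugate (inv g) c \<in> fixer (act g ` V)"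
proof -
  have c: "c \<in> carrier G" using assms by (simp add: fixer_def)
  show ?thesis
    using assms c act_image_subset[OF assms(2,3)] act_image_inv[OF assms(2,3)]
    by (simp add: conjugate_in_fixer_iff)
qed

text \<open>A commutator is the identity on a neighbourhood \<open>U\<close> of the left end, so it commutes with every
element \<open>c s\<close> whose support lies in \<open>U\<close> and hence belongs to \<open>S\<close> if \<open>s \<in> S\<close>.\<close>

lemma absorbing_subgroup_contradiction:
  assumes \<phi>: "\<phi> \<in> characters" and S: "subgroup S G" "S \<subset> ker \<phi>" "absorbs c (ker \<phi>) S"
    and c: "c \<in> carrier G"
    and move: "\<And>U. U \<in> E \<Longrightarrow> \<exists>s\<in>S. \<exists>V. U \<union> V = X \<and> c \<otimes> s \<in> fixer V"
  shows False
proof -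
  have "x \<otimes> y \<otimes> inv x \<otimes> inv y \<in> S" if xy: "x \<in> carrier G" "y \<in> carrier G" for x y
  proof -
    let ?k = "x \<otimes> y \<otimes> inv x \<otimes> inv y"
    have k: "?k \<in> carrier G" "?k \<in> ker \<phi>" "L ?k = 0"
      using xy character_commutator \<phi> left.L_character by (auto simp: ker_iff)
    then obtain U where U: "U \<in> E" "?k \<in> fixer U" using left.L_zero_iff by blast
    obtain s V where s: "s \<in> S" "U \<union> V = X" "c \<otimes> s \<in> fixer V" using move[OF U(1)] by blast
    show ?thesis
      using absorbs_commuting[OF S(3,1) c s(1) k(2,1) fixers_commute[OF U(2) s(3,2)]] .
  qed
  then have "ker \<phi> \<subseteq> S"
    using S by (intro absorbs_commutators[OF S(3,1) c]) (auto simp: ker_iff)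
  with S(2) show False by blast
qed

text \<open>Conjugating \<open>c\<close> moves its support into any neighbourhood of the left end. The conjugate differs
from \<open>c\<close> by an element \<open>s\<close> of the kernel of \<open>\<phi>\<close>. This \<open>s\<close> is the identity where both \<open>c\<close> and its
conjugate are, so it commutes with \<open>d\<close>, and therefore \<open>s \<in> S\<close>.\<close>

lemma opposite_supports:
  assumes \<phi>: "\<phi> \<in> characters" "exceptional \<phi>"
    and c: "c \<in> fixer V" "V \<in> F" and d: "d \<in> fixer U" "U \<in> E" and UV: "U \<union> V = X"
    and neg: "\<phi> c < 0" "\<phi> d < 0"
  shows False
proof -
  have cd: "c \<in> carrier G" "d \<in> carrier G" using c d by (auto simp: fixer_def)
  have V: "V \<subseteq> X" using right.nbhd_subset c(2) .
  obtain S where S: "subgroup S G" "S \<subset> ker \<phi>" "absorbs c (ker \<phi>) S" "absorbs d (ker \<phi>) S"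
    using \<phi>(2)[unfolded exceptional_def] cd neg by blast
  show False
  proof (rule absorbing_subgroup_contradiction[OF \<phi>(1) S(1-3) cd(1)])
    fix U' assume U': "U' \<in> E"
    obtain g where g: "g \<in> carrier G" "U' \<union> act g ` V = X" using cover[OF U' c(2)] by blast
    let ?V = "act g ` V" and ?c = "conjugate (inv g) c" and ?s = "inv c \<otimes> conjugate (inv g) c"
    have c': "?c \<in> fixer ?V" "?c \<in> carrier G" using fixer_conjugate[OF c(1) g(1) V] cd g by auto
    show "\<exists>s\<in>S. \<exists>W. U' \<union> W = X \<and> c \<otimes> s \<in> fixer W"
    proof (cases "?V \<subseteq> V")
      case True
      then have "U' \<union> V = X" using g(2) V left.nbhd_subset[OF U'] by blast
      then show ?thesis
        using c(1) cd subgroup.one_closed[OF S(1)] by (intro bexI[of _ \<one>] exI[of _ V]) auto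
    next
      case False
      then have "V \<subseteq> ?V" using right.nbhd_chain[OF c(2) right.nbhd_image[OF g(1) c(2)]] by blast
      then have "?s \<in> fixer V"
        using fixer_subgroup[OF V] c'(1) c(1) fixer_antimono[of V ?V]
        by (intro subgroup.m_closed subgroup.m_inv_closed) auto
      then have "?s \<otimes> d = d \<otimes> ?s"
        using fixers_commute[of ?s V d U] d(1) UV by (simp add: Un_commute)
      moreover have "?s \<in> ker \<phi>"
        using cd c' g(1) \<phi>(1) by (simp add: ker_iff character_mult[OF \<phi>(1)]
            character_inv[OF \<phi>(1)] character_conjugate[OF \<phi>(1)])
      ultimately have "?s \<in> S"
        using cd c' by (intro absorbs_centralizer[OF S(4,1) cd(2)]) auto
      moreover have "c \<otimes> ?s \<in> fixer ?V" using cd c' by (simp add: inv_cancel)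
      ultimately show ?thesis using g(2) by blast
    qed
  qed
qed

text \<open>First choose a conjugate \<open>c z\<close> of \<open>c\<close> with support in a neighbourhood of the left end that the
inverse of \<open>c\<close> contracts. Conjugating by \<open>c\<^sup>m\<close> for large \<open>m\<close> has two effects: it pushes the
support of \<open>c z\<close> into any given neighbourhood of the end, and it moves \<open>z\<close> into \<open>S\<close>. Only for an
expanding \<open>c\<close> do these effects go together.\<close>

lemma wrong_direction:
  assumes \<phi>: "\<phi> \<in> characters" "exceptional \<phi>"
    and c: "c \<in> ker R" "\<phi> c < 0" "L c > 0"
  shows False
proof -
  have cG: "c \<in> carrier G" using c by (simp add: ker_iff)
  obtain V where V: "V \<in> F" "c \<in> fixer V" using c(1) right.L_zero_iff by (auto simp: ker_iff)
  have VX: "V \<subseteq> X" using right.nbhd_subset V(1) .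
  obtain S where S: "subgroup S G" "S \<subset> ker \<phi>" "absorbs c (ker \<phi>) S"
    using \<phi>(2)[unfolded exceptional_def] cG c(2) by blast
  have "L (inv c) < 0" using c(3) character_inv[OF left.L_character cG] by simp
  then obtain U where U: "U \<in> E" "\<forall>V\<in>E. V \<subseteq> U \<longrightarrow> act (inv c) ` V \<subseteq> V"
      "\<forall>V\<in>E. \<exists>n::nat. act (inv c [^] n) ` U \<subseteq> V"
    using left.contracting[of "inv c"] cG by auto
  have UX: "U \<subseteq> X" using left.nbhd_subset U(1) .
  obtain f where f: "f \<in> carrier G" "U \<union> act f ` V = X" using cover[OF U(1) V(1)] by blast
  let ?c = "conjugate (inv f) c" and ?W = "act f ` V"
  have c': "?c \<in> fixer ?W" "?c \<in> carrier G" using fixer_conjugate[OF V(2) f(1) VX] f cG by auto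
  have WX: "?W \<subseteq> X" using act_image_subset[OF f(1) VX] .
  define z where "z = inv c \<otimes> ?c"
  have z: "z \<in> carrier G" "z \<in> ker \<phi>"
    using cG f(1) c' \<phi>(1) by (auto simp: z_def ker_iff character_mult[OF \<phi>(1)]
        character_inv[OF \<phi>(1)] character_conjugate[OF \<phi>(1)])
  then obtain p :: nat where p: "conjugate (c [^] p) z \<in> S"
    using S(3) by (auto simp: absorbs_def)
  show False
  proof (rule absorbing_subgroup_contradiction[OF \<phi>(1) S cG])
    fix U' assume U': "U' \<in> E"
    obtain q :: nat where q: "act (inv c [^] q) ` U \<subseteq> U'" using U(3) U' by blast
    define m where "m = max p q"
    let ?g = "inv (c [^] m)"
    have g: "c [^] m \<in> carrier G" "?g \<in> carrier G" using cG by auto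
    have zS: "conjugate (c [^] m) z \<in> S"
      using absorbs_pow_mono[OF S(3) cG z(1) p] by (simp add: m_def)
    have "act (inv c [^] m) ` U \<subseteq> U'"
      using left.contracting_eventually[OF _ U(1) _ q, of m] U(1,2) cG by (simp add: m_def)
    then have gU: "act ?g ` U \<subseteq> U'" using cG by (simp add: nat_pow_inv)
    have "act ?g ` (U \<union> ?W) = X"
    proof
      show "act ?g ` (U \<union> ?W) \<subseteq> X" using act_image_subset[OF g(2), of X] f(2) by simp
      show "X \<subseteq> act ?g ` (U \<union> ?W)"
        unfolding f(2) using act_inv(1)[OF g(1)] act_closed[OF g(1)] by (metis image_eqI subsetI)
    qed
    then have "U' \<union> act ?g ` ?W = X"
      using gU left.nbhd_subset[OF U'] by (auto simp: image_Un)
    moreover have "conjugate (c [^] m) ?c \<in> fixer (act ?g ` ?W)"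
      using fixer_conjugate[OF c'(1) g(2) WX] g by simp
    moreover have "conjugate (c [^] m) ?c = c \<otimes> conjugate (c [^] m) z"
    proof -
      have "conjugate (c [^] m) c = c"
        using cG by (intro conjugate_commuting commute_nat_pow) auto
      moreover have "?c = c \<otimes> z" using cG c' by (simp add: z_def inv_cancel)
      ultimately show ?thesis using g(1) cG z(1) by (simp add: conjugate_distrib)
    qed
    ultimately show "\<exists>s\<in>S. \<exists>V. U' \<union> V = X \<and> c \<otimes> s \<in> fixer V" using zS by metis
  qed
qed

text \<open>An element that is the identity near both ends has conjugates with disjoint supports, which rules
out a negative value of \<open>\<phi>\<close>.\<close>

lemma exceptional_vanishes:
  assumes \<phi>: "\<phi> \<in> characters" "exceptional \<phi>" and c: "c \<in> ker L" "c \<in> ker R"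
  shows "\<phi> c = 0"
proof (rule ccontr)
  assume ne: "\<phi> c \<noteq> 0"
  have no_neg: False if c: "c \<in> ker L" "c \<in> ker R" "\<phi> c < 0" for c
  proof -
    have cG: "c \<in> carrier G" using c by (simp add: ker_iff)
    obtain U where U: "U \<in> E" "c \<in> fixer U" using c left.L_zero_iff by (auto simp: ker_iff)
    obtain V where V: "V \<in> F" "c \<in> fixer V" using c right.L_zero_iff by (auto simp: ker_iff)
    obtain g where g: "g \<in> carrier G" "V \<union> act g ` U = X" using cover_right[OF U(1) V(1)] by blast
    have "conjugate (inv g) c \<in> fixer (act g ` U)"
      using fixer_conjugate[OF U(2) g(1) left.nbhd_subset[OF U(1)]] .
    moreover have "\<phi> (conjugate (inv g) c) < 0"
      using character_conjugate[OF \<phi>(1), of "inv g" c] g(1) cG c(3) by simp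
    ultimately show False
      using opposite_supports[OF \<phi> V(2,1) _ left.nbhd_image[OF g(1) U(1)]] g(2) c(3)
      by (simp add: Un_commute)
  qed
  have cG: "c \<in> carrier G" using c by (simp add: ker_iff)
  have "inv c \<in> ker L" "inv c \<in> ker R" "\<phi> (inv c) = - \<phi> c"
    using c cG character_inv[OF left.L_character] character_inv[OF right.L_character]
      character_inv[OF \<phi>(1)] by (auto simp: ker_iff)
  then show False using no_neg[of c] no_neg[of "inv c"] c ne by linarith
qed

lemma exceptional_on_ker_R:
  assumes \<phi>: "\<phi> \<in> characters" "exceptional \<phi>"
  shows "\<exists>s\<ge>0. \<forall>c\<in>ker R. \<phi> c = s * L c"
proof (rule character_proportional[OF \<phi>(1) left.L_character ker_subgroup[OF right.L_character]])
  fix c assume c: "c \<in> ker R" "\<phi> c < 0"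
  have "L c \<noteq> 0" using exceptional_vanishes[OF \<phi>, of c] c by (auto simp: ker_iff)
  then show "L c < 0" using wrong_direction[OF \<phi> c] by fastforce
qed

text \<open>On the kernel of \<open>R\<close> the character \<open>\<phi>\<close> is a non-negative multiple of \<open>L\<close>, on the kernel of \<open>L\<close> it
is a non-negative multiple of \<open>R\<close>. As the two kernels generate the group up to torsion,
\<open>\<phi> = s L + t R\<close> with \<open>s, t \<ge> 0\<close>. If both coefficients were positive, \<open>\<phi>\<close> would be negative on
contractions at either end with disjoint supports.\<close>

theorem exceptional_imp_proportional:
  assumes \<phi>: "\<phi> \<in> characters" "exceptional \<phi>" and ne: "\<exists>g\<in>carrier G. \<phi> g \<noteq> 0"
  shows "\<exists>s>0. (\<forall>g\<in>carrier G. \<phi> g = s * L g) \<or> (\<forall>g\<in>carrier G. \<phi> g = s * R g)"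
proof -
  obtain s where s: "s \<ge> 0" "\<And>c. c \<in> ker R \<Longrightarrow> \<phi> c = s * L c"
    using exceptional_on_ker_R[OF \<phi>] by blast
  obtain t where t: "t \<ge> 0" "\<And>c. c \<in> ker L \<Longrightarrow> \<phi> c = t * R c"
    using two_ends.exceptional_on_ker_R[OF swap \<phi>] by blast
  have comb: "\<phi> g = s * L g + t * R g" if g: "g \<in> carrier G" for g
  proof -
    obtain n :: nat and u v where *: "n > 0" "u \<in> ker L" "v \<in> ker R" "g [^] n = u \<otimes> v"
      using virtually_product[OF g] by blast
    have uv: "u \<in> carrier G" "L u = 0" "v \<in> carrier G" "R v = 0" using * by (auto simp: ker_iff)
    have val: "n * \<theta> g = \<theta> u + \<theta> v" if "\<theta> \<in> characters" for \<theta> :: "'a \<Rightarrow> real"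
      using character_pow[OF that g, of n] *(4) character_mult[OF that uv(1,3)] by simp
    have "n * \<phi> g = t * R u + s * L v" using val[OF \<phi>(1)] s(2) t(2) *(2,3) by simp
    also have "\<dots> = n * (s * L g + t * R g)"
      using val[OF left.L_character] val[OF right.L_character] uv by (simp add: algebra_simps)
    finally show ?thesis using *(1) by simp
  qed
  have "s = 0 \<or> t = 0"
  proof (rule ccontr)
    assume "\<not> (s = 0 \<or> t = 0)"
    then have pos: "s > 0" "t > 0" using s(1) t(1) by auto
    obtain c where c: "c \<in> ker R" "L c < 0" using ex_ker_R_neg by blast
    obtain d where d: "d \<in> ker L" "R d < 0" using two_ends.ex_ker_R_neg[OF swap] by blast
    have cd: "c \<in> carrier G" "d \<in> carrier G" using c d by (auto simp: ker_iff)
    obtain V where V: "V \<in> F" "c \<in> fixer V" using c right.L_zero_iff by (auto simp: ker_iff)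
    obtain U where U: "U \<in> E" "d \<in> fixer U" using d left.L_zero_iff by (auto simp: ker_iff)
    obtain g where g: "g \<in> carrier G" "U \<union> act g ` V = X" using cover[OF U(1) V(1)] by blast
    have "\<phi> (conjugate (inv g) c) < 0" "\<phi> d < 0"
      using character_conjugate[OF \<phi>(1), of "inv g" c] g(1) cd s(2)[OF c(1)] t(2)[OF d(1)]
        c(2) d(2) pos by (auto simp: mult_pos_neg)
    then show False
      using opposite_supports[OF \<phi> fixer_conjugate[OF V(2) g(1) right.nbhd_subset[OF V(1)]]
          right.nbhd_image[OF g(1) V(1)] U(2,1) g(2)] by blast
  qed
  moreover have "s \<noteq> 0 \<or> t \<noteq> 0" using ne comb by auto
  ultimately show ?thesis
  proof (elim disjE)
    assume "s = 0" "t \<noteq> 0"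
    then show ?thesis using comb t(1) by (intro exI[of _ t]) auto
  next
    assume "t = 0" "s \<noteq> 0"
    then show ?thesis using comb s(1) by (intro exI[of _ s]) auto
  qed auto
qed

lemma L_R_independent: "\<not> (\<forall>g\<in>carrier G. L g = s * R g)"
proof
  assume L_eq: "\<forall>g\<in>carrier G. L g = s * R g"
  obtain c where "c \<in> ker R" "L c < 0" using ex_ker_R_neg by blast
  then show False using L_eq by (simp add: ker_iff)
qed

end

section \<open>Invariant characters and twisted conjugacy classes\<close>

context group
begin

lemma iso_surj:
  assumes "\<alpha> \<in> iso G G" "h \<in> carrier G"
  obtains g where "g \<in> carrier G" "\<alpha> g = h"
proof -
  have "h \<in> \<alpha> ` carrier G" using assms by (simp add: iso_def bij_betw_def)
  then show thesis using that by blast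
qed

lemma iso_closed: "\<lbrakk>\<alpha> \<in> iso G G; g \<in> carrier G\<rbrakk> \<Longrightarrow> \<alpha> g \<in> carrier G"
  using hom_in_carrier[of \<alpha> G G g] by (simp add: iso_def)

lemma scale_factor_unit:
  assumes \<alpha>: "\<alpha> \<in> iso G G" and s: "s \<noteq> 0" and scale: "\<And>g. g \<in> carrier G \<Longrightarrow> \<phi> (\<alpha> g) = s * \<phi> g"
  shows "s \<in> unit_group (\<phi> ` carrier G)"
proof -
  have "(\<lambda>x. s * x) ` \<phi> ` carrier G = \<phi> ` \<alpha> ` carrier G"
    by (auto simp: image_image scale intro!: image_cong)
  also have "\<alpha> ` carrier G = carrier G" using \<alpha> by (simp add: iso_def bij_betw_def)
  finally show ?thesis using s by (simp add: unit_group_def)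
qed

text \<open>An automorphism that sends \<open>\<phi>\<close> to \<open>s \<phi>\<close> with \<open>s > 0\<close> has \<open>s = 1\<close>, because \<open>s\<close> is a unit of the
image of \<open>\<phi>\<close>. Consequently two automorphisms that send \<open>\<phi>\<close> to multiples of \<open>\<theta>\<close> send it to the same
multiple, and the orbit of \<open>\<phi>\<close> consists of \<open>\<phi>\<close> alone or of \<open>\<phi>\<close> and one further character
\<open>\<phi> \<circ> \<beta>\<close>. The sum over the orbit is invariant. In the second case it does not vanish since \<open>\<phi>\<close> is not
a multiple of \<open>\<theta>\<close>.\<close>

lemma invariant_character_from_orbit:
  assumes \<phi>: "\<phi> \<in> characters" "\<exists>g\<in>carrier G. \<phi> g \<noteq> 0"
    and unit: "unit_group (\<phi> ` carrier G) = {1, -1}"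
    and indep: "\<And>s. \<not> (\<forall>g\<in>carrier G. \<phi> g = s * \<theta> g)"
    and orbit: "\<And>\<alpha>. \<alpha> \<in> iso G G \<Longrightarrow>
      \<exists>s>0. (\<forall>g\<in>carrier G. \<phi> (\<alpha> g) = s * \<phi> g) \<or> (\<forall>g\<in>carrier G. \<phi> (\<alpha> g) = s * \<theta> g)"
  shows "\<exists>\<psi>\<in>characters. (\<exists>g\<in>carrier G. \<psi> g \<noteq> 0) \<and>
           (\<forall>\<alpha>\<in>iso G G. \<forall>g\<in>carrier G. \<psi> (\<alpha> g) = \<psi> g)"
proof -
  have scale1: "\<forall>g\<in>carrier G. \<phi> (\<alpha> g) = \<phi> g"
    if "\<alpha> \<in> iso G G" "s > 0" "\<forall>g\<in>carrier G. \<phi> (\<alpha> g) = s * \<phi> g" for \<alpha> s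
  proof -
    have "s \<in> {1, -1}" using scale_factor_unit[OF that(1), of s \<phi>] that(2,3) unit by auto
    then show ?thesis using that(2,3) by auto
  qed
  show ?thesis
  proof (cases "\<exists>\<alpha>\<in>iso G G. \<exists>s>0. \<forall>g\<in>carrier G. \<phi> (\<alpha> g) = s * \<theta> g")
    case False
    then have "\<forall>\<alpha>\<in>iso G G. \<forall>g\<in>carrier G. \<phi> (\<alpha> g) = \<phi> g" using orbit scale1 by metis
    then show ?thesis using \<phi> by blast
  next
    case True
    then obtain \<beta> s where \<beta>: "\<beta> \<in> iso G G" "s > 0" "\<forall>g\<in>carrier G. \<phi> (\<beta> g) = s * \<theta> g" by blast
    have not_fixed: "\<not> (\<forall>g\<in>carrier G. \<phi> (\<beta> g) = \<phi> g)" using \<beta>(3) indep[of s] by metis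
    have two: "(\<forall>g\<in>carrier G. \<phi> (\<alpha> g) = \<phi> g) \<or> (\<forall>g\<in>carrier G. \<phi> (\<alpha> g) = \<phi> (\<beta> g))"
      if \<alpha>: "\<alpha> \<in> iso G G" for \<alpha>
    proof -
      obtain t where t: "t > 0"
        "(\<forall>g\<in>carrier G. \<phi> (\<alpha> g) = t * \<phi> g) \<or> (\<forall>g\<in>carrier G. \<phi> (\<alpha> g) = t * \<theta> g)"
        using orbit[OF \<alpha>] by blast
      then show ?thesis
      proof (elim disjE)
        assume *: "\<forall>g\<in>carrier G. \<phi> (\<alpha> g) = t * \<theta> g"
        let ?\<gamma> = "inv_into (carrier G) \<beta>"
        have \<gamma>: "?\<gamma> \<in> iso G G" using iso_set_sym[OF \<beta>(1)] .
        have \<beta>\<gamma>: "\<beta> (?\<gamma> h) = h" if "h \<in> carrier G" for h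
          using \<beta>(1) that by (intro f_inv_into_f) (simp add: iso_def bij_betw_def)
        have "\<forall>h\<in>carrier G. \<phi> ((\<alpha> \<circ> ?\<gamma>) h) = t / s * \<phi> h"
        proof
          fix h assume h: "h \<in> carrier G"
          then have "\<phi> (\<alpha> (?\<gamma> h)) = t * \<theta> (?\<gamma> h)" "\<phi> h = s * \<theta> (?\<gamma> h)"
            using * \<beta>(3) iso_closed[OF \<gamma>] \<beta>\<gamma>[OF h] by metis+
          then show "\<phi> ((\<alpha> \<circ> ?\<gamma>) h) = t / s * \<phi> h" using \<beta>(2) by simp
        qed
        then have eq: "\<forall>h\<in>carrier G. \<phi> ((\<alpha> \<circ> ?\<gamma>) h) = \<phi> h"
          using scale1[OF iso_set_trans[OF \<gamma> \<alpha>], of "t / s"] t(1) \<beta>(2) by simp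
        have "\<phi> (\<alpha> g) = \<phi> (\<beta> g)" if "g \<in> carrier G" for g
        proof -
          have "?\<gamma> (\<beta> g) = g"
            using \<beta>(1) that by (intro inv_into_f_f) (simp_all add: iso_def bij_betw_def)
          then show ?thesis using eq iso_closed[OF \<beta>(1) that] by fastforce
        qed
        then show ?thesis by blast
      qed (use scale1[OF \<alpha>] in blast)
    qed
    let ?\<psi> = "\<lambda>g. \<phi> g + (\<phi> \<circ> \<beta>) g"
    have "?\<psi> \<in> characters" using character_add[OF \<phi>(1) character_auto[OF \<phi>(1) \<beta>(1)]] .
    moreover have "\<exists>g\<in>carrier G. ?\<psi> g \<noteq> 0"
    proof (rule ccontr)
      assume "\<not> (\<exists>g\<in>carrier G. ?\<psi> g \<noteq> 0)"
      then have "\<forall>g\<in>carrier G. \<phi> g = - s * \<theta> g" using \<beta>(3) by (auto simp: add_eq_0_iff2)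
      with indep show False by blast
    qed
    moreover have "\<forall>\<alpha>\<in>iso G G. \<forall>g\<in>carrier G. ?\<psi> (\<alpha> g) = ?\<psi> g"
    proof
      fix \<alpha> assume \<alpha>: "\<alpha> \<in> iso G G"
      have distinct: "\<exists>g\<in>carrier G. \<phi> (\<beta> (\<alpha> g)) \<noteq> \<phi> (\<alpha> g)"
        using not_fixed iso_surj[OF \<alpha>] by metis
      show "\<forall>g\<in>carrier G. ?\<psi> (\<alpha> g) = ?\<psi> g"
        using two[OF \<alpha>] two[OF iso_set_trans[OF \<alpha> \<beta>(1)]] distinct by force
    qed
    ultimately show ?thesis by (intro bexI[of _ ?\<psi>] conjI)
  qed
qed

text \<open>An invariant character takes the same value at \<open>x\<close> and at \<open>g x \<alpha>(g)\<^sup>-\<^sup>1\<close>, so the powers of an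
element with non-zero value lie in pairwise distinct twisted conjugacy classes.\<close>

lemma property_R_infinityI:
  assumes \<psi>: "\<psi> \<in> characters" and a: "a \<in> carrier G" "\<psi> a \<noteq> 0"
    and inv: "\<And>\<alpha> g. \<lbrakk>\<alpha> \<in> auto G; g \<in> carrier G\<rbrakk> \<Longrightarrow> \<psi> (\<alpha> g) = \<psi> g"
  shows "property_R_infinity G"
  unfolding property_R_infinity_def
proof
  fix \<alpha> assume \<alpha>: "\<alpha> \<in> auto G"
  interpret \<alpha>: group_hom G G \<alpha>
    using \<alpha> by (simp add: group_hom_def group_hom_axioms_def auto_def is_group)
  define C where "C = (\<lambda>n::nat. orbit G (\<lambda>g x. g \<otimes> x \<otimes> inv (\<alpha> g)) (a [^] n))"
  have "inj C"
  proof (rule injI)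
    fix m n assume eq: "C m = C n"
    have "\<one> \<otimes> a [^] m \<otimes> inv (\<alpha> \<one>) = a [^] m" using a(1) by simp
    then have "a [^] m \<in> C m" unfolding C_def orbit_def using one_closed by force
    then have "a [^] m \<in> C n" by (simp only: eq)
    then have "\<exists>g. a [^] m = g \<otimes> a [^] n \<otimes> inv (\<alpha> g) \<and> g \<in> carrier G"
      by (simp only: C_def orbit_def mem_Collect_eq)
    then obtain g where g: "g \<in> carrier G" "a [^] m = g \<otimes> a [^] n \<otimes> inv (\<alpha> g)"
      by (elim exE conjE)
    have "\<psi> (a [^] m) = \<psi> (a [^] n)"
      using g(1) a(1) inv[OF \<alpha> g(1)]
      by (simp add: g(2) character_mult[OF \<psi>] character_inv[OF \<psi>])
    then show "m = n" using a by (simp add: character_pow[OF \<psi> a(1)])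
  qed
  then have "infinite (range C)" using finite_imageD by blast
  moreover have "range C \<subseteq> twisted_conjugacy_classes G \<alpha>"
    using a(1) by (auto simp: C_def twisted_conjugacy_classes_def orbits_def)
  ultimately show "infinite (twisted_conjugacy_classes G \<alpha>)" using finite_subset by blast
qed

end

theorem (in two_ends) invariant_character:
  assumes "unit_group (L ` carrier G) = {1, -1}"
  shows "\<exists>\<psi>\<in>characters. (\<exists>g\<in>carrier G. \<psi> g \<noteq> 0) \<and>
           (\<forall>\<alpha>\<in>iso G G. \<forall>g\<in>carrier G. \<psi> (\<alpha> g) = \<psi> g)"
proof (rule invariant_character_from_orbit[OF left.L_character L_nonzero assms L_R_independent])
  fix \<alpha> assume \<alpha>: "\<alpha> \<in> iso G G"
  have "\<exists>g\<in>carrier G. (L \<circ> \<alpha>) g \<noteq> 0"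
    using L_nonzero iso_surj[OF \<alpha>] by (metis comp_apply)
  then show "\<exists>s>0. (\<forall>g\<in>carrier G. L (\<alpha> g) = s * L g) \<or> (\<forall>g\<in>carrier G. L (\<alpha> g) = s * R g)"
    using exceptional_imp_proportional[OF character_auto[OF left.L_character \<alpha>]
        exceptional_auto[OF exceptional_L \<alpha>]] by simp
qed

section \<open>Germs of piecewise linear homeomorphisms at the end points\<close>

context
  fixes b :: real and g :: "real \<Rightarrow> real"
  assumes b_pos: "b > 0" and g: "g \<in> PLo_carrier b"
begin

lemma PLo_bij: "bij_betw g {0..b} {0..b}"
  using g by (simp add: PLo_carrier_def Bij_def)

lemma PLo_closed: "x \<in> {0..b} \<Longrightarrow> g x \<in> {0..b}"
  using PLo_bij by (meson bij_betwE)

lemma PLo_less_iff: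
  assumes "x \<in> {0..b}" "y \<in> {0..b}"
  shows "g x < g y \<longleftrightarrow> x < y"
  using g assms strict_mono_on_less[of "{0..b}" g] by (simp add: PLo_carrier_def)

lemma PLo_end_fixed:
  assumes "e \<in> {0, b}"
  shows "g e = e"
proof -
  have e: "e \<in> {0..b}" using assms b_pos by auto
  then have "e \<in> g ` {0..b}" using bij_betw_imp_surj_on[OF PLo_bij] by simp
  then obtain x where x: "x \<in> {0..b}" "g x = e" by (elim imageE) simp
  have "x = e"
    using assms PLo_less_iff[OF x(1) e] PLo_less_iff[OF e x(1)] x PLo_closed[OF e] by force
  then show ?thesis using x by simp
qed

lemma PLo_interior:
  assumes "x \<in> {0<..<b}"
  shows "g x \<in> {0<..<b}"
  using assms PLo_less_iff[of 0 x] PLo_less_iff[of x b] PLo_end_fixed[of 0] PLo_end_fixed[of b] by auto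

lemma PLo_dist_le_iff:
  assumes "e \<in> {0, b}" "x \<in> {0..b}" "y \<in> {0..b}"
  shows "\<bar>g x - e\<bar> \<le> \<bar>g y - e\<bar> \<longleftrightarrow> \<bar>x - e\<bar> \<le> \<bar>y - e\<bar>"
  using assms PLo_less_iff[of x y] PLo_less_iff[of y x] PLo_closed[of x] PLo_closed[of y] by auto

text \<open>No break point other than possibly \<open>e\<close> itself lies in the open interval of radius
\<open>\<epsilon>\<close> around \<open>e\<close>, where \<open>\<epsilon>\<close> is the minimum of \<open>b\<close> and the distances of \<open>e\<close> to the remaining break
points.\<close>

lemma PLo_germ:
  assumes e: "e \<in> {0, b}"
  shows "\<exists>s>0. \<exists>\<epsilon>>0. \<forall>x\<in>{0..b}. \<bar>x - e\<bar> \<le> \<epsilon> \<longrightarrow> g x = e + s * (x - e)"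
proof -
  obtain P where P: "finite P"
      "\<forall>x y. 0 \<le> x \<and> x \<le> y \<and> y \<le> b \<and> {x<..<y} \<inter> P = {} \<longrightarrow> (\<exists>m c. \<forall>t\<in>{x..y}. g t = m * t + c)"
    using g by (auto simp: PLo_carrier_def piecewise_linear_on_def)
  define \<epsilon> where "\<epsilon> = Min (insert b ((\<lambda>p. \<bar>p - e\<bar>) ` (P - {e})))"
  have \<epsilon>: "\<epsilon> > 0" "\<epsilon> \<le> b" using P(1) b_pos by (auto simp: \<epsilon>_def)
  have far: "\<epsilon> \<le> \<bar>p - e\<bar>" if "p \<in> P" "p \<noteq> e" for p
    using P(1) that unfolding \<epsilon>_def by (intro Min_le) auto
  define l where "l = max 0 (e - \<epsilon>)"
  define r where "r = min b (e + \<epsilon>)"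
  have lr: "0 \<le> l" "l \<le> r" "r \<le> b" "l \<le> e" "e \<le> r" using e \<epsilon> by (auto simp: l_def r_def)
  have "{l<..<r} \<inter> P = {}" using e far \<epsilon> by (force simp: l_def r_def)
  then have "\<exists>m c. \<forall>t\<in>{l..r}. g t = m * t + c" using P(2) lr by simp
  then obtain m c where mc: "\<forall>t\<in>{l..r}. g t = m * t + c" by blast
  have lin: "g x = e + m * (x - e)" if "x \<in> {0..b}" "\<bar>x - e\<bar> \<le> \<epsilon>" for x
  proof -
    have "x \<in> {l..r}" "e \<in> {l..r}" using that lr by (auto simp: l_def r_def)
    then have "g x = m * x + c" "e = m * e + c" using mc PLo_end_fixed[OF e] by auto
    then show ?thesis by (simp add: algebra_simps)
  qed
  have "m > 0"
  proof (cases "e = 0")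
    case True
    then show ?thesis using lin[of \<epsilon>] \<epsilon> PLo_less_iff[of 0 \<epsilon>] PLo_end_fixed[OF e]
      by (auto simp: zero_less_mult_iff)
  next
    case False
    then have "e = b" using e by simp
    then show ?thesis using lin[of "b - \<epsilon>"] \<epsilon> PLo_less_iff[of "b - \<epsilon>" b] PLo_end_fixed[OF e]
      by (auto simp: zero_less_mult_iff)
  qed
  then show ?thesis using lin \<epsilon>(1) by blast
qed

end

text \<open>The derivative within the closed interval is one-sided at either end point, so this single notion
covers \<open>\<sigma>\<^sub>\<ell>\<close> and \<open>\<sigma>\<^sub>r\<close>.\<close>

definition end_slope :: "real \<Rightarrow> real \<Rightarrow> (real \<Rightarrow> real) \<Rightarrow> real" where
  "end_slope b e g = vector_derivative g (at e within {0..b})"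

lemma chi_eq_ln_end_slope:
  assumes "b > 0"
  shows "chi_left g = ln (end_slope b 0 g)" "chi_right b g = ln (end_slope b b g)"
  using assms by (simp_all add: chi_left_def sigma_left_def chi_right_def sigma_right_def end_slope_def
      at_within_Icc_at_right at_within_Icc_at_left)

lemma end_slope_eqI:
  assumes "b > 0" "e \<in> {0, b}" "\<epsilon> > 0"
    and "\<And>x. \<lbrakk>x \<in> {0..b}; \<bar>x - e\<bar> \<le> \<epsilon>\<rbrakk> \<Longrightarrow> g x = e + s * (x - e)"
  shows "end_slope b e g = s"
proof -
  have "((\<lambda>x. e + s * (x - e)) has_vector_derivative s) (at e within {0..b})"
    by (auto intro!: derivative_eq_intros simp: has_vector_derivative_def)
  then have "(g has_vector_derivative s) (at e within {0..b})"
    by (rule has_vector_derivative_transform_within[where d = \<epsilon>])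
      (use assms in \<open>auto simp: dist_real_def\<close>)
  then show ?thesis
    unfolding end_slope_def using assms(1,2)
    by (intro vector_derivative_within_closed_interval) auto
qed

lemma end_slope_germ:
  assumes "b > 0" "g \<in> PLo_carrier b" "e \<in> {0, b}"
  shows "end_slope b e g > 0"
    and "\<exists>\<epsilon>>0. \<forall>x\<in>{0..b}. \<bar>x - e\<bar> \<le> \<epsilon> \<longrightarrow> g x = e + end_slope b e g * (x - e)"
proof -
  obtain s \<epsilon> where *: "s > 0" "\<epsilon> > 0" "\<forall>x\<in>{0..b}. \<bar>x - e\<bar> \<le> \<epsilon> \<longrightarrow> g x = e + s * (x - e)"
    using PLo_germ[OF assms] by blast
  moreover have "end_slope b e g = s" using * by (intro end_slope_eqI[OF assms(1,3) *(2)]) blast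
  ultimately show "end_slope b e g > 0"
    and "\<exists>\<epsilon>>0. \<forall>x\<in>{0..b}. \<bar>x - e\<bar> \<le> \<epsilon> \<longrightarrow> g x = e + end_slope b e g * (x - e)"
    by auto
qed

lemma end_slope_compose:
  assumes b: "b > 0" and gh: "g \<in> PLo_carrier b" "h \<in> PLo_carrier b" and e: "e \<in> {0, b}"
  shows "end_slope b e (compose {0..b} g h) = end_slope b e g * end_slope b e h"
proof -
  let ?s = "end_slope b e g" and ?t = "end_slope b e h"
  obtain \<epsilon> where \<epsilon>: "\<epsilon> > 0" "\<forall>x\<in>{0..b}. \<bar>x - e\<bar> \<le> \<epsilon> \<longrightarrow> g x = e + ?s * (x - e)"
    using end_slope_germ[OF b gh(1) e] by blast
  obtain \<delta> where \<delta>: "\<delta> > 0" "\<forall>x\<in>{0..b}. \<bar>x - e\<bar> \<le> \<delta> \<longrightarrow> h x = e + ?t * (x - e)"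
    using end_slope_germ[OF b gh(2) e] by blast
  have t: "?t > 0" using end_slope_germ[OF b gh(2) e] by blast
  show ?thesis
  proof (rule end_slope_eqI[OF b e])
    show "min \<delta> (\<epsilon> / ?t) > 0" using \<epsilon> \<delta> t by simp
    fix x assume x: "x \<in> {0..b}" "\<bar>x - e\<bar> \<le> min \<delta> (\<epsilon> / ?t)"
    then have hx: "h x = e + ?t * (x - e)" using \<delta> by simp
    then have "\<bar>h x - e\<bar> = ?t * \<bar>x - e\<bar>" using t by (simp add: abs_mult)
    also have "\<dots> \<le> \<epsilon>" using x(2) t by (simp add: field_simps)
    finally have "\<bar>h x - e\<bar> \<le> \<epsilon>" .
    then have "g (h x) = e + ?s * (h x - e)" using \<epsilon>(2) PLo_closed[OF b gh(2) x(1)] by blast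
    then show "compose {0..b} g h x = e + ?s * ?t * (x - e)"
      using hx x(1) by (simp add: compose_def)
  qed
qed

text \<open>Neighbourhoods of the end point \<open>e\<close> in the open interval. They are indexed by a boundary point
\<open>p\<close> rather than by a radius, so that the image of the neighbourhood with boundary point \<open>p\<close> under \<open>g\<close>
is the one with boundary point \<open>g p\<close>.\<close>

definition near :: "real \<Rightarrow> real \<Rightarrow> real \<Rightarrow> real set" where
  "near b e p = {x \<in> {0<..<b}. \<bar>x - e\<bar> \<le> \<bar>p - e\<bar>}"

section \<open>Irreducible groups of piecewise linear homeomorphisms\<close>

locale PL_group =
  fixes b :: real and H :: "(real \<Rightarrow> real) set" and G (structure)
  assumes b: "b > 0" and H: "subgroup H (PLo b)" and G: "G = PLo b \<lparr>carrier := H\<rparr>"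
    and irreducible: "\<not> (\<exists>t\<in>{0<..<b}. \<forall>g\<in>carrier G. g t = t)"
begin

lemma carrier_PLo: "g \<in> carrier G \<Longrightarrow> g \<in> PLo_carrier b"
  using subgroup.subset[OF H] by (auto simp: G PLo_def)

lemma mult_eq: "\<lbrakk>g \<in> carrier G; h \<in> carrier G\<rbrakk> \<Longrightarrow> g \<otimes> h = compose {0..b} g h"
  using carrier_PLo[of g] carrier_PLo[of h] by (auto simp: G PLo_def BijGroup_def PLo_carrier_def)

lemma one_eq: "\<one> = (\<lambda>x\<in>{0..b}. x)"
  by (simp add: G PLo_def BijGroup_def)

sublocale group G
  unfolding G using group.subgroup_imp_group[OF group_PLo H] .

sublocale faithful_action G "{0<..<b}" "\<lambda>g. g"
proof unfold_locales
  fix g h x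
  show "\<lbrakk>g \<in> carrier G; x \<in> {0<..<b}\<rbrakk> \<Longrightarrow> g x \<in> {0<..<b}"
    using PLo_interior[OF b carrier_PLo] .
  show "x \<in> {0<..<b} \<Longrightarrow> \<one> x = x" by (simp add: one_eq)
  show "\<lbrakk>g \<in> carrier G; h \<in> carrier G; x \<in> {0<..<b}\<rbrakk> \<Longrightarrow> (g \<otimes> h) x = g (h x)"
    by (simp add: mult_eq compose_def)
next
  fix g h assume gh: "g \<in> carrier G" "h \<in> carrier G" and eq: "\<And>x. x \<in> {0<..<b} \<Longrightarrow> g x = h x"
  have ext: "f \<in> extensional {0..b}" if "f \<in> carrier G" for f
    using carrier_PLo[OF that] by (simp add: PLo_carrier_def Bij_def)
  show "g = h"
  proof (rule extensionalityI[OF ext[OF gh(1)] ext[OF gh(2)]])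
    fix x assume "x \<in> {0..b}"
    then consider "x \<in> {0<..<b}" | "x \<in> {0, b}" by fastforce
    then show "g x = h x"
    proof cases
      case 2
      then show ?thesis
        using PLo_end_fixed[OF b carrier_PLo[OF gh(1)]] PLo_end_fixed[OF b carrier_PLo[OF gh(2)]]
        by simp
    qed (rule eq)
  qed
qed

lemma near_image:
  assumes g: "g \<in> carrier G" and e: "e \<in> {0, b}" and p: "p \<in> {0<..<b}"
  shows "g ` near b e p = near b e (g p)"
proof
  note iff = PLo_dist_le_iff[OF b carrier_PLo[OF g] e]
  show "g ` near b e p \<subseteq> near b e (g p)"
    using iff[of _ p] p act_closed[OF g] by (auto simp: near_def)
  show "near b e (g p) \<subseteq> g ` near b e p"
  proof
    fix y assume y: "y \<in> near b e (g p)"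
    define x where "x = (inv g) y"
    have x: "x \<in> {0<..<b}" "g x = y" using y act_closed[of "inv g" y] act_inv(2)[OF g, of y] g
      by (auto simp: x_def near_def)
    then have "x \<in> near b e p" using y iff[of x p] p by (auto simp: near_def)
    then show "y \<in> g ` near b e p" using x by blast
  qed
qed

lemma near_subset_iff:
  assumes "p \<in> {0<..<b}" "q \<in> {0<..<b}"
  shows "near b e p \<subseteq> near b e q \<longleftrightarrow> \<bar>p - e\<bar> \<le> \<bar>q - e\<bar>"
proof
  assume "near b e p \<subseteq> near b e q"
  then show "\<bar>p - e\<bar> \<le> \<bar>q - e\<bar>" using assms(1) by (force simp: near_def)
qed (auto simp: near_def)

lemma ex_closer:
  assumes e: "e \<in> {0, b}" and "\<epsilon> > 0"
  shows "\<exists>p\<in>{0<..<b}. \<bar>p - e\<bar> < \<epsilon>"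
proof -
  let ?d = "min \<epsilon> b / 2"
  have "?d > 0" "?d < b" "?d < \<epsilon>" using b assms(2) by (auto simp: min_def)
  then show ?thesis
    using e by (intro bexI[of _ "\<bar>e - ?d\<bar>"]) auto
qed

lemma action_end:
  assumes e: "e \<in> {0, b}"
  shows "action_end G {0<..<b} (\<lambda>g. g) (near b e ` {0<..<b}) (\<lambda>g. ln (end_slope b e g))"
proof (intro action_end.intro action_end_axioms.intro)
  show "faithful_action G {0<..<b} (\<lambda>g. g)" by unfold_locales
  show "U \<subseteq> {0<..<b}" if "U \<in> near b e ` {0<..<b}" for U using that by (auto simp: near_def)
  show "U \<subseteq> V \<or> V \<subseteq> U" if "U \<in> near b e ` {0<..<b}" "V \<in> near b e ` {0<..<b}" for U V
    using that by (auto simp: near_def)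
  show "g ` U \<in> near b e ` {0<..<b}" if "g \<in> carrier G" "U \<in> near b e ` {0<..<b}" for g U
    using that near_image[OF that(1) e] act_closed[OF that(1)] by auto
  show "\<exists>U\<in>near b e ` {0<..<b}. x \<notin> U" if x: "x \<in> {0<..<b}" for x
  proof -
    have "\<bar>x - e\<bar> > 0" using x e by auto
    then obtain p where "p \<in> {0<..<b}" "\<bar>p - e\<bar> < \<bar>x - e\<bar>" using ex_closer[OF e] by blast
    then show ?thesis by (intro bexI[of _ "near b e p"]) (auto simp: near_def)
  qed
  note pos = end_slope_germ(1)[OF b carrier_PLo e]
  show "(\<lambda>g. ln (end_slope b e g)) \<in> characters"
  proof (rule homI)
    fix g h assume gh: "g \<in> carrier G" "h \<in> carrier G"
    then show "ln (end_slope b e (g \<otimes> h)) =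
        ln (end_slope b e g) \<otimes>\<^bsub>real_additive_group\<^esub> ln (end_slope b e h)"
      using end_slope_compose[OF b carrier_PLo carrier_PLo e, of g h] pos[of g] pos[of h]
      by (simp add: mult_eq real_additive_group_def ln_mult)
  qed (simp add: real_additive_group_def)
  show "ln (end_slope b e g) = 0 \<longleftrightarrow> (\<exists>U\<in>near b e ` {0<..<b}. g \<in> fixer U)"
    if g: "g \<in> carrier G" for g
  proof -
    obtain \<epsilon> where \<epsilon>: "\<epsilon> > 0" "\<forall>x\<in>{0..b}. \<bar>x - e\<bar> \<le> \<epsilon> \<longrightarrow> g x = e + end_slope b e g * (x - e)"
      using end_slope_germ(2)[OF b carrier_PLo[OF g] e] by blast
    show ?thesis
    proof
      assume "ln (end_slope b e g) = 0"
      then have s: "end_slope b e g = 1" using pos[OF g] by simp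
      obtain p where p: "p \<in> {0<..<b}" "\<bar>p - e\<bar> < \<epsilon>" using ex_closer[OF e \<epsilon>(1)] by blast
      then have "g \<in> fixer (near b e p)" using g \<epsilon>(2) s by (auto simp: fixer_def near_def)
      then show "\<exists>U\<in>near b e ` {0<..<b}. g \<in> fixer U" using p(1) by blast
    next
      assume "\<exists>U\<in>near b e ` {0<..<b}. g \<in> fixer U"
      then obtain p where p: "p \<in> {0<..<b}" "g \<in> fixer (near b e p)" by blast
      have "min \<epsilon> \<bar>p - e\<bar> > 0" using \<epsilon>(1) p(1) e by auto
      then obtain x where x: "x \<in> {0<..<b}" "\<bar>x - e\<bar> < min \<epsilon> \<bar>p - e\<bar>" using ex_closer[OF e] by blast
      then have "g x = x" using p(2) by (simp add: fixer_def near_def)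
      moreover have "g x = e + end_slope b e g * (x - e)" using \<epsilon>(2) x by simp
      ultimately have "(end_slope b e g - 1) * (x - e) = 0" by (simp add: algebra_simps)
      moreover have "x \<noteq> e" using x(1) e by auto
      ultimately show "ln (end_slope b e g) = 0" by simp
    qed
  qed
  show "\<exists>U\<in>near b e ` {0<..<b}. (\<forall>V\<in>near b e ` {0<..<b}. V \<subseteq> U \<longrightarrow> g ` V \<subseteq> V) \<and>
        (\<forall>V\<in>near b e ` {0<..<b}. \<exists>n::nat. (g [^] n) ` U \<subseteq> V)"
    if g: "g \<in> carrier G" "ln (end_slope b e g) < 0" for g
  proof -
    let ?s = "end_slope b e g"
    have s: "0 < ?s" "?s < 1" using g(2) pos[OF g(1)] by auto
    obtain \<epsilon> where \<epsilon>: "\<epsilon> > 0" "\<forall>x\<in>{0..b}. \<bar>x - e\<bar> \<le> \<epsilon> \<longrightarrow> g x = e + ?s * (x - e)"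
      using end_slope_germ(2)[OF b carrier_PLo[OF g(1)] e] by blast
    have step: "\<bar>g x - e\<bar> = ?s * \<bar>x - e\<bar>" if "x \<in> {0<..<b}" "\<bar>x - e\<bar> \<le> \<epsilon>" for x
      using that \<epsilon>(2) s by (simp add: abs_mult)
    have le: "\<bar>g x - e\<bar> \<le> \<bar>x - e\<bar>" if "x \<in> {0<..<b}" "\<bar>x - e\<bar> \<le> \<epsilon>" for x
      unfolding step[OF that] using s by (simp add: mult_left_le_one_le)
    have pow: "\<bar>(g [^] n) x - e\<bar> = ?s ^ n * \<bar>x - e\<bar>" if "x \<in> {0<..<b}" "\<bar>x - e\<bar> \<le> \<epsilon>" for n :: nat and x
      using that
    proof (induction n arbitrary: x)
      case 0
      then show ?case by (simp add: act_one)
    next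
      case (Suc n)
      have "(g [^] Suc n) x = (g [^] n) (g x)" using g(1) Suc.prems(1) by (simp add: act_mult)
      then show ?case
        using Suc.IH[OF act_closed[OF g(1) Suc.prems(1)]] step[OF Suc.prems] le[OF Suc.prems]
          Suc.prems(2) by simp
    qed
    obtain p where p: "p \<in> {0<..<b}" "\<bar>p - e\<bar> < \<epsilon>" using ex_closer[OF e \<epsilon>(1)] by blast
    show ?thesis
    proof (intro bexI[of _ "near b e p"] conjI ballI impI)
      fix V assume "V \<in> near b e ` {0<..<b}" "V \<subseteq> near b e p"
      then obtain q where q: "q \<in> {0<..<b}" "V = near b e q" "\<bar>q - e\<bar> \<le> \<bar>p - e\<bar>"
        using near_subset_iff p(1) by blast
      then show "g ` V \<subseteq> V"
        using near_image[OF g(1) e q(1)] near_subset_iff[OF act_closed[OF g(1) q(1)] q(1), of e]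
          le[OF q(1)] p(2) by simp
    next
      fix V assume "V \<in> near b e ` {0<..<b}"
      then obtain q where q: "q \<in> {0<..<b}" "V = near b e q" by blast
      have "\<bar>q - e\<bar> > 0" "\<bar>p - e\<bar> > 0" using q(1) p(1) e by auto
      then obtain n where "?s ^ n < \<bar>q - e\<bar> / \<bar>p - e\<bar>"
        using real_arch_pow_inv[of "\<bar>q - e\<bar> / \<bar>p - e\<bar>" ?s] s by auto
      then have "\<bar>(g [^] n) p - e\<bar> \<le> \<bar>q - e\<bar>"
        using pow[OF p(1), of n] p(2) \<open>\<bar>p - e\<bar> > 0\<close> by (simp add: field_simps)
      then show "\<exists>n::nat. (g [^] n) ` near b e p \<subseteq> V"
        using near_image[OF nat_pow_closed[OF g(1)] e p(1)] q
          near_subset_iff[OF act_closed[OF nat_pow_closed[OF g(1)] p(1)] q(1)] by auto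
    qed (use p in simp)
  qed
qed

text \<open>The infimum of the orbit of \<open>x\<close> is fixed by the whole group, so by irreducibility it cannot be an
interior point.\<close>

lemma orbit_reaches_left:
  assumes x: "x \<in> {0<..<b}" and y: "y \<in> {0<..<b}"
  shows "\<exists>g\<in>carrier G. g x \<le> y"
proof (rule ccontr)
  assume "\<not> ?thesis"
  then have above: "y < g x" if "g \<in> carrier G" for g using that by force
  let ?O = "(\<lambda>g. g x) ` carrier G"
  define t where "t = Inf ?O"
  have bdd: "bdd_below ?O" using above by (intro bdd_belowI[of _ y]) force
  have lower: "t \<le> g x" if "g \<in> carrier G" for g
    unfolding t_def using that bdd by (intro cInf_lower) auto
  have "y \<le> t" unfolding t_def using above by (intro cInf_greatest) force+
  moreover have "t \<le> x" using lower[OF one_closed] act_one[OF x] by simp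
  ultimately have t: "t \<in> {0<..<b}" using x y by auto
  have ge: "t \<le> g t" if g: "g \<in> carrier G" for g
  proof (rule ccontr)
    assume "\<not> t \<le> g t"
    then have "(inv g) (g t) < (inv g) t"
      using PLo_less_iff[OF b carrier_PLo, of "inv g" "g t" t] g t act_closed[OF g t] by simp
    then have "t < (inv g) t" using act_inv(1)[OF g t] by simp
    then obtain h where h: "h \<in> carrier G" "h x < (inv g) t"
      using cInf_less_iff[OF _ bdd, of "(inv g) t"] by (auto simp: t_def)
    have "g (h x) < g ((inv g) t)"
      using PLo_less_iff[OF b carrier_PLo[OF g], of "h x" "(inv g) t"] h
        act_closed[OF h(1) x] act_closed[of "inv g" t] g t by simp
    then have "(g \<otimes> h) x < t" using act_inv(2)[OF g t] act_mult[OF g h(1) x] by simp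
    then show False using lower[of "g \<otimes> h"] g h(1) by simp
  qed
  have "g t = t" if g: "g \<in> carrier G" for g
  proof (rule antisym)
    have "\<not> (inv g) t < (inv g) (g t)"
      using ge[of "inv g"] g act_inv(1)[OF g t] by simp
    then show "g t \<le> t"
      using PLo_less_iff[OF b carrier_PLo, of "inv g" t "g t"] g t act_closed[OF g t] by simp
  qed (rule ge[OF g])
  then show False using irreducible t by blast
qed

lemma two_ends:
  assumes "\<exists>g\<in>carrier G. chi_left g \<noteq> 0" "\<exists>g\<in>carrier G. chi_right b g \<noteq> 0"
    and tors: "torsion_group (G Mod (ker chi_left <#> ker (chi_right b)))"
  shows "two_ends G {0<..<b} (\<lambda>g. g) (near b 0 ` {0<..<b}) chi_left (near b b ` {0<..<b}) (chi_right b)"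
proof -
  have chi: "chi_left = (\<lambda>g. ln (end_slope b 0 g))" "chi_right b = (\<lambda>g. ln (end_slope b b g))"
    using chi_eq_ln_end_slope[OF b] by auto
  interpret left: action_end G "{0<..<b}" "\<lambda>g. g" "near b 0 ` {0<..<b}" chi_left
    unfolding chi by (rule action_end) simp
  interpret right: action_end G "{0<..<b}" "\<lambda>g. g" "near b b ` {0<..<b}" "chi_right b"
    unfolding chi by (rule action_end) simp
  show ?thesis
  proof unfold_locales
    fix U V assume "U \<in> near b 0 ` {0<..<b}" "V \<in> near b b ` {0<..<b}"
    then obtain p q where p: "p \<in> {0<..<b}" "U = near b 0 p" and q: "q \<in> {0<..<b}" "V = near b b q"
      by blast
    obtain g where g: "g \<in> carrier G" "g q \<le> p" using orbit_reaches_left[OF q(1) p(1)] by blast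
    have "near b 0 p \<union> near b b (g q) = {0<..<b}"
      using g(2) p(1) act_closed[OF g(1) q(1)] by (auto simp: near_def)
    then show "\<exists>g\<in>carrier G. U \<union> g ` V = {0<..<b}"
      using near_image[OF g(1) _ q(1), of b] g(1) p(2) q(2) by auto
  next
    let ?N = "ker chi_left <#> ker (chi_right b)"
    fix g assume g: "g \<in> carrier G"
    have "?N \<lhd> G"
      using normal_subgroup_set_mult_closed[OF ker_normal[OF left.L_character] ker_normal[OF right.L_character]] .
    then interpret N: normal ?N G .
    have "?N #> g \<in> carrier (G Mod ?N)" using g by (auto simp: carrier_FactGroup)
    then obtain n :: nat where n: "n > 0" "(?N #> g) [^]\<^bsub>G Mod ?N\<^esub> n = \<one>\<^bsub>G Mod ?N\<^esub>"
      using tors unfolding torsion_group_def by blast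
    then have "?N #> g [^] n = ?N" using N.FactGroup_pow[OF g, of n] by simp
    then have "g [^] n \<in> ?N" using coset_join1[OF _ nat_pow_closed[OF g] N.subgroup_axioms] by simp
    then show "\<exists>n>0. \<exists>u\<in>ker chi_left. \<exists>v\<in>ker (chi_right b). g [^] (n::nat) = u \<otimes> v"
      using n(1) by (auto simp: set_mult_def)
  qed (use assms in auto)
qed

end

theorem theorem1p7:
  fixes b :: real and H :: "(real \<Rightarrow> real) set" and G :: "(real \<Rightarrow> real) monoid"
  assumes "b > 0"
    and "subgroup H (PLo b)"
    and G_def: "G = PLo b \<lparr>carrier := H\<rparr>"
    and "\<not> (\<exists>t\<in>{0<..<b}. \<forall>g\<in>carrier G. g t = t)"
    and "\<exists>g\<in>carrier G. chi_left g \<noteq> 0"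
    and "\<exists>g\<in>carrier G. chi_right b g \<noteq> 0"
    and "torsion_group (G Mod (kernel G real_additive_group chi_left
                                 <#>\<^bsub>G\<^esub> kernel G real_additive_group (chi_right b)))"
    and "unit_group (chi_left ` carrier G) = {1, -1} \<or> unit_group (chi_right b ` carrier G) = {1, -1}"
  shows "(\<exists>\<psi> \<in> hom G positive_real_group.
            (\<exists>g\<in>carrier G. \<psi> g \<noteq> 1) \<and>
            (\<forall>\<alpha>\<in>auto G. \<forall>g\<in>carrier G. \<psi> (\<alpha> g) = \<psi> g))
         \<and> property_R_infinity G"
proof -
  interpret PL_group b H G by (rule PL_group.intro[OF assms(1-4)])
  note ends = two_ends[OF assms(5-7)]
  have "\<exists>\<psi>\<in>characters. (\<exists>g\<in>carrier G. \<psi> g \<noteq> 0) \<and>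
      (\<forall>\<alpha>\<in>iso G G. \<forall>g\<in>carrier G. \<psi> (\<alpha> g) = \<psi> g)"
    using assms(8)
  proof
    assume "unit_group (chi_left ` carrier G) = {1, -1}"
    then show ?thesis by (rule two_ends.invariant_character[OF ends])
  next
    assume "unit_group (chi_right b ` carrier G) = {1, -1}"
    then show ?thesis by (rule two_ends.invariant_character[OF two_ends.swap[OF ends]])
  qed
  then obtain \<psi> where \<psi>: "\<psi> \<in> characters" "\<exists>g\<in>carrier G. \<psi> g \<noteq> 0"
      "\<forall>\<alpha>\<in>iso G G. \<forall>g\<in>carrier G. \<psi> (\<alpha> g) = \<psi> g"
    by (metis (no_types, lifting))
  then obtain a where a: "a \<in> carrier G" "\<psi> a \<noteq> 0" by (elim bexE)
  have auto_iso: "auto G \<subseteq> iso G G" by (auto simp: auto_def iso_def Bij_def)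
  have "(\<lambda>g. exp (\<psi> g)) \<in> hom G positive_real_group"
    by (rule homI) (auto simp: positive_real_group_def character_mult[OF \<psi>(1)] exp_add)
  moreover have "property_R_infinity G"
    by (rule property_R_infinityI[OF \<psi>(1) a]) (use \<psi>(3) auto_iso in auto)
  ultimately show ?thesis
    using \<psi>(3) auto_iso a by (intro conjI bexI[of _ "\<lambda>g. exp (\<psi> g)"] bexI[of _ a]) auto
qed

end
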